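(* Let $(A,\cdot,+)$ be a linear cycle set and $\Gamma$ be an abelian group, and use the notation of the context. (1) The abelian groups $\Gamma^{(A^{\times(i+j)})}$, $i\geqslant0$, $j\geqslant1$, together with the linear maps $\partial^h_{i,j}$ and $\partial^v_{i,j}$, form a chain bicomplex, i.e. $$\partial^h_{i-1,j}\partial^h_{i,j}=0\quad(i\geqslant2,\ j\geqslant1),$$ $$\partial^v_{i,j-1}\partial^v_{i,j}=0\quad(i\geqslant0,\ j\geqslant3),$$ $$\partial^h_{i,j-1}\partial^v_{i,j}=\partial^v_{i-1,j}\partial^h_{i,j}\quad(i\geqslant1,\ j\geqslant2).$$ Moreover, these maps restrict to the subgroups $ShC_{i,j}(A;\Gamma)$ and $C^{\mathrm D}_{i,j}(A;\Gamma)$, and thus induce chain bicomplex structures on $C_{i,j}(A;\Gamma)$ and on $C^{\mathrm N}_{i,j}(A;\Gamma)$. (2) The linear maps $\partial_h^{i,j}$ and $\partial_v^{i,j}$ yield a cochain bicomplex structure for the abelian groups $\operatorname{Fun}(A^{\times(i+j)},\Gamma)$, $i\geqslant0$, $j\geqslant1$. This structure restricts to $C^{i,j}(A;\Gamma)$ and further to $C^{i,j}_{\mathrm N}(A;\Gamma)$.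
   Context: A cycle set is a set $X$ with a binary operation $\cdot$ such that all left translations $a\mapsto b\cdot a$ are bijective and $(a\cdot b)\cdot(a\cdot c)=(b\cdot a)\cdot(b\cdot c)$ for all $a,b,c$. A linear cycle set is a cycle set $(A,\cdot)$ with an abelian group operation $+$ satisfying $a\cdot(b+c)=a\cdot b+a\cdot c$ and $(a+b)\cdot c=(a\cdot b)\cdot(a\cdot c)$ for all $a,b,c\in A$. $\Gamma^{(A^{\times n})}$ denotes the group of formal $\Gamma$-linear combinations of $n$-tuples of elements of $A$; $\operatorname{Fun}(A^{\times n},\Gamma)$ the group of all maps $A^{\times n}\to\Gamma$. Bicomplexes here have commuting (not anticommuting) horizontal and vertical differentials. Elementary maps (extended linearly): $\partial_{n;0}(a_1,\ldots,a_n)=(a_1\cdot a_2,\ldots,a_1\cdot a_n)$; $\partial_{n;i}(a_1,\ldots,a_n)=(a_1,\ldots,a_i+a_{i+1},\ldots,a_n)$ for $1\leqslant i\leqslant n-1$; $\partial'_{n;i}(a_1,\ldots,a_n)=(a_1,\ldots,a_{i-1},a_{i+1},\ldots,a_n)$ for $1\leqslant i\leqslant n$. Differentials: $$\partial^h_{i,j}=\partial_{i+j;0}+\sum_{k=1}^{i-1}(-1)^k\partial_{i+j;k}+(-1)^i\partial'_{i+j;i}\qquad(i\geqslant1,\ j\geqslant1),$$ $$-\partial^v_{i,j}=\partial'_{i+j;i+1}+\sum_{k=1}^{j-1}(-1)^k\partial_{i+j;i+k}+(-1)^j\partial'_{i+j;i+j}\qquad(i\geqslant0,\ j\geqslant2),$$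 empty sums being zero. Here $\partial^h_{i,j}$ goes from bidegree $(i,j)$ to $(i-1,j)$ and $\partial^v_{i,j}$ from $(i,j)$ to $(i,j-1)$. Subgroups and quotients, for $i\geqslant0$, $j\geqslant1$: $ShC_{i,j}(A;\Gamma)$ is the subgroup of $\Gamma^{(A^{\times(i+j)})}$ generated by the partial shuffles $$\sum_{\sigma\in Sh_{r,j-r}}(-1)^\sigma\gamma(a_1,\ldots,a_i,a_{i+\sigma^{-1}(1)},\ldots,a_{i+\sigma^{-1}(j)})$$ for all $1\leqslant r\leqslant j-1$, $a_k\in A$, $\gamma\in\Gamma$, where $Sh_{r,j-r}$ is the set of permutations $\sigma$ of $\{1,\ldots,j\}$ with $\sigma(1)\leqslant\cdots\leqslant\sigma(r)$ and $\sigma(r+1)\leqslant\cdots\leqslant\sigma(j)$, and $(-1)^\sigma$ is the sign. $C^{\mathrm D}_{i,j}(A;\Gamma)$ is the subgroup of $\Gamma^{(A^{\times(i+j)})}$ generated by the degenerate tuples $\gamma(a_1,\ldots,a_{i+j})$, i.e. those with some $a_k=0$. $C_{i,j}(A;\Gamma)=\Gamma^{(A^{\times(i+j)})}/ShC_{i,j}(A;\Gamma)$ and $C^{\mathrm N}_{i,j}(A;\Gamma)=\Gamma^{(A^{\times(i+j)})}/(C^{\mathrm D}_{i,j}(A;\Gamma)+ShC_{i,j}(A;\Gamma))$. Dual objects, for $i\geqslant0$, $j\geqslant1$ and $f\in\operatorname{Fun}(A^{\times(i+j)},\Gamma)$ extended linearly to $\mathbb Z^{(A^{\times(i+j)})}$: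 $\partial_h^{i,j}f=f\circ\partial^h_{i+1,j}$ and $\partial_v^{i,j}f=f\circ\partial^v_{i,j+1}$ (with the differentials for $\mathbb Z$-coefficients). $C^{i,j}(A;\Gamma)$ is the group of maps $A^{\times(i+j)}\to\Gamma$ whose linearization vanishes on all partial shuffles (with $\gamma$ omitted), and $C^{i,j}_{\mathrm N}(A;\Gamma)\subseteq C^{i,j}(A;\Gamma)$ consists of those that moreover vanish on all degenerate $(i+j)$-tuples. *)

theory Defs
  imports
    "HOL-Library.Poly_Mapping"
    "HOL-Combinatorics.Permutations"
    "HOL-Algebra.Coset"
    "HOL-Algebra.Generated_Groups"
    "HOL-Algebra.Product_Groups"
begin

section \<open>Linear cycle sets\<close>

locale cycle_set =
  fixes dot :: "'a \<Rightarrow> 'a \<Rightarrow> 'a"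
  assumes bij_dot: "bij (dot b)"
    and cycle: "dot (dot a b) (dot a c) = dot (dot b a) (dot b c)"

locale linear_cycle_set = cycle_set dot
  for dot :: "'a::ab_group_add \<Rightarrow> 'a \<Rightarrow> 'a" +
  assumes dot_add_right: "dot a (b + c) = dot a b + dot a c"
    and dot_add_left: "dot (a + b) c = dot (dot a b) (dot a c)"

section \<open>Chain and cochain bicomplexes of abelian groups\<close>

text \<open>
  Bicomplexes live in bidegrees \<open>(i, j)\<close> with \<open>i \<ge> 0\<close> and \<open>j \<ge> 1\<close>, and their horizontal and vertical
  differentials commute. The groups are written multiplicatively, as everywhere in HOL-Algebra, so
  that \<open>\<one>\<close> is the zero element. In the chain case \<open>dh i j\<close> and \<open>dv i j\<close> start in bidegree \<open>(i, j)\<close>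
  and are subject to conditions only if they end in an admissible bidegree.
\<close>

locale chain_bicomplex =
  fixes C :: "nat \<Rightarrow> nat \<Rightarrow> 'x monoid"
    and dh dv :: "nat \<Rightarrow> nat \<Rightarrow> 'x \<Rightarrow> 'x"
  assumes comm_group: "1 \<le> j \<Longrightarrow> comm_group (C i j)"
    and dh_hom: "1 \<le> i \<Longrightarrow> 1 \<le> j \<Longrightarrow> dh i j \<in> hom (C i j) (C (i - 1) j)"
    and dv_hom: "2 \<le> j \<Longrightarrow> dv i j \<in> hom (C i j) (C i (j - 1))"
    and dh_dh: "2 \<le> i \<Longrightarrow> 1 \<le> j \<Longrightarrow> x \<in> carrier (C i j) \<Longrightarrow>
      dh (i - 1) j (dh i j x) = \<one>\<^bsub>C (i - 2) j\<^esub>"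
    and dv_dv: "3 \<le> j \<Longrightarrow> x \<in> carrier (C i j) \<Longrightarrow>
      dv i (j - 1) (dv i j x) = \<one>\<^bsub>C i (j - 2)\<^esub>"
    and dh_dv: "1 \<le> i \<Longrightarrow> 2 \<le> j \<Longrightarrow> x \<in> carrier (C i j) \<Longrightarrow>
      dh i (j - 1) (dv i j x) = dv (i - 1) j (dh i j x)"

locale cochain_bicomplex =
  fixes C :: "nat \<Rightarrow> nat \<Rightarrow> 'x monoid"
    and dh dv :: "nat \<Rightarrow> nat \<Rightarrow> 'x \<Rightarrow> 'x"
  assumes comm_group: "1 \<le> j \<Longrightarrow> comm_group (C i j)"
    and dh_hom: "1 \<le> j \<Longrightarrow> dh i j \<in> hom (C i j) (C (i + 1) j)"
    and dv_hom: "1 \<le> j \<Longrightarrow> dv i j \<in> hom (C i j) (C i (j + 1))"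
    and dh_dh: "1 \<le> j \<Longrightarrow> x \<in> carrier (C i j) \<Longrightarrow>
      dh (i + 1) j (dh i j x) = \<one>\<^bsub>C (i + 2) j\<^esub>"
    and dv_dv: "1 \<le> j \<Longrightarrow> x \<in> carrier (C i j) \<Longrightarrow>
      dv i (j + 1) (dv i j x) = \<one>\<^bsub>C i (j + 2)\<^esub>"
    and dh_dv: "1 \<le> j \<Longrightarrow> x \<in> carrier (C i j) \<Longrightarrow>
      dh i (j + 1) (dv i j x) = dv (i + 1) j (dh i j x)"

definition chain_restricts_to ::
  "(nat \<Rightarrow> nat \<Rightarrow> 'x monoid) \<Rightarrow> (nat \<Rightarrow> nat \<Rightarrow> 'x \<Rightarrow> 'x) \<Rightarrow> (nat \<Rightarrow> nat \<Rightarrow> 'x \<Rightarrow> 'x) \<Rightarrow>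
    (nat \<Rightarrow> nat \<Rightarrow> 'x set) \<Rightarrow> bool"
  where "chain_restricts_to C dh dv H \<longleftrightarrow>
    (\<forall>i. \<forall>j\<ge>1. subgroup (H i j) (C i j)) \<and>
    chain_bicomplex (\<lambda>i j. (C i j)\<lparr>carrier := H i j\<rparr>) dh dv"

definition cochain_restricts_to ::
  "(nat \<Rightarrow> nat \<Rightarrow> 'x monoid) \<Rightarrow> (nat \<Rightarrow> nat \<Rightarrow> 'x \<Rightarrow> 'x) \<Rightarrow> (nat \<Rightarrow> nat \<Rightarrow> 'x \<Rightarrow> 'x) \<Rightarrow>
    (nat \<Rightarrow> nat \<Rightarrow> 'x set) \<Rightarrow> bool"
  where "cochain_restricts_to C dh dv H \<longleftrightarrow>
    (\<forall>i. \<forall>j\<ge>1. subgroup (H i j) (C i j)) \<and>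
    cochain_bicomplex (\<lambda>i j. (C i j)\<lparr>carrier := H i j\<rparr>) dh dv"

text \<open>
  The map on cosets \<open>H + x \<mapsto> H' + f x\<close>. It is meaningful only if the coset \<open>H' + f x\<close> does not depend
  on the representative \<open>x\<close>; this is part of the following definition.
\<close>

definition induced_map :: "'x monoid \<Rightarrow> 'x set \<Rightarrow> ('x \<Rightarrow> 'x) \<Rightarrow> 'x set \<Rightarrow> 'x set"
  where "induced_map G' H' f X = the_elem ((\<lambda>x. H' #>\<^bsub>G'\<^esub> f x) ` X)"

definition induces_quotient_chain_bicomplex ::
  "(nat \<Rightarrow> nat \<Rightarrow> 'x monoid) \<Rightarrow> (nat \<Rightarrow> nat \<Rightarrow> 'x \<Rightarrow> 'x) \<Rightarrow> (nat \<Rightarrow> nat \<Rightarrow> 'x \<Rightarrow> 'x) \<Rightarrow>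
    (nat \<Rightarrow> nat \<Rightarrow> 'x set) \<Rightarrow> bool"
  where "induces_quotient_chain_bicomplex C dh dv H \<longleftrightarrow>
    (let dh' = \<lambda>i j. induced_map (C (i - 1) j) (H (i - 1) j) (dh i j);
         dv' = \<lambda>i j. induced_map (C i (j - 1)) (H i (j - 1)) (dv i j)
     in (\<forall>i. \<forall>j\<ge>1. H i j \<lhd> C i j) \<and>
        (\<forall>i\<ge>1. \<forall>j\<ge>1. \<forall>x\<in>carrier (C i j).
           dh' i j (H i j #>\<^bsub>C i j\<^esub> x) = H (i - 1) j #>\<^bsub>C (i - 1) j\<^esub> dh i j x) \<and>
        (\<forall>i. \<forall>j\<ge>2. \<forall>x\<in>carrier (C i j).
           dv' i j (H i j #>\<^bsub>C i j\<^esub> x) = H i (j - 1) #>\<^bsub>C i (j - 1)\<^esub> dv i j x) \<and>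
        chain_bicomplex (\<lambda>i j. C i j Mod H i j) dh' dv')"

section \<open>Formal linear combinations of tuples\<close>

text \<open>
  An \<open>n\<close>-tuple is a list of length \<open>n\<close>. The entry \<open>a\<^sub>k\<close> of the tuple \<open>as\<close> is \<open>as ! (k - 1)\<close>.
\<close>

definition tuples :: "nat \<Rightarrow> 'a list set"
  where "tuples n = {as. length as = n}"

definition chain_group :: "nat \<Rightarrow> ('a list \<Rightarrow>\<^sub>0 'g::ab_group_add) monoid"
  where "chain_group n =
    \<lparr>carrier = {c. Poly_Mapping.keys c \<subseteq> tuples n}, monoid.mult = (+), one = 0\<rparr>"

definition int_smult :: "int \<Rightarrow> 'g::ab_group_add \<Rightarrow> 'g"
  where "int_smult n x = (\<Sum>_<nat n. x) - (\<Sum>_<nat (- n). x)"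

definition linear_ext :: "('a list \<Rightarrow> 'a list) \<Rightarrow> ('a list \<Rightarrow>\<^sub>0 'g::ab_group_add) \<Rightarrow> ('a list \<Rightarrow>\<^sub>0 'g)"
  where "linear_ext \<phi> c =
    (\<Sum>as\<in>Poly_Mapping.keys c. Poly_Mapping.single (\<phi> as) (Poly_Mapping.lookup c as))"

definition act_face :: "('a \<Rightarrow> 'a \<Rightarrow> 'a) \<Rightarrow> 'a list \<Rightarrow> 'a list"
  where "act_face dot as = map (dot (hd as)) (tl as)"

definition add_face :: "nat \<Rightarrow> 'a::ab_group_add list \<Rightarrow> 'a list"
  where "add_face i as = take (i - 1) as @ [as ! (i - 1) + as ! i] @ drop (i + 1) as"

definition del_face :: "nat \<Rightarrow> 'a list \<Rightarrow> 'a list"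
  where "del_face i as = take (i - 1) as @ drop i as"

definition dh :: "('a::ab_group_add \<Rightarrow> 'a \<Rightarrow> 'a) \<Rightarrow> nat \<Rightarrow> nat \<Rightarrow>
    ('a list \<Rightarrow>\<^sub>0 'g::ab_group_add) \<Rightarrow> ('a list \<Rightarrow>\<^sub>0 'g)"
  where "dh dot i j c =
    linear_ext (act_face dot) c
    + (\<Sum>k=1..i-1. int_smult ((-1) ^ k) (linear_ext (add_face k) c))
    + int_smult ((-1) ^ i) (linear_ext (del_face i) c)"

definition dv :: "nat \<Rightarrow> nat \<Rightarrow>
    ('a::ab_group_add list \<Rightarrow>\<^sub>0 'g::ab_group_add) \<Rightarrow> ('a list \<Rightarrow>\<^sub>0 'g)"
  where "dv i j c =
    - (linear_ext (del_face (i + 1)) c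
       + (\<Sum>k=1..j-1. int_smult ((-1) ^ k) (linear_ext (add_face (i + k)) c))
       + int_smult ((-1) ^ j) (linear_ext (del_face (i + j)) c))"

section \<open>Partial shuffles and degenerate tuples\<close>

definition Sh :: "nat \<Rightarrow> nat \<Rightarrow> (nat \<Rightarrow> nat) set"
  where "Sh r s = {\<sigma>. \<sigma> permutes {1..r + s} \<and> mono_on {1..r} \<sigma> \<and> mono_on {r + 1..r + s} \<sigma>}"

definition partial_shuffle ::
  "nat \<Rightarrow> nat \<Rightarrow> nat \<Rightarrow> 'a list \<Rightarrow> 'g::ab_group_add \<Rightarrow> ('a list \<Rightarrow>\<^sub>0 'g)"
  where "partial_shuffle i j r as \<gamma> =
    (\<Sum>\<sigma>\<in>Sh r (j - r). int_smult (sign \<sigma>)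
       (Poly_Mapping.single
         (take i as @ map (\<lambda>k. as ! (i + inv_into UNIV \<sigma> k - 1)) [1..<j + 1]) \<gamma>))"

definition ShC :: "nat \<Rightarrow> nat \<Rightarrow> ('a list \<Rightarrow>\<^sub>0 'g::ab_group_add) set"
  where "ShC i j = generate (chain_group (i + j))
    {partial_shuffle i j r as \<gamma> | r as \<gamma>. 1 \<le> r \<and> r \<le> j - 1 \<and> as \<in> tuples (i + j)}"

definition CD :: "nat \<Rightarrow> nat \<Rightarrow> ('a::zero list \<Rightarrow>\<^sub>0 'g::ab_group_add) set"
  where "CD i j = generate (chain_group (i + j))
    {Poly_Mapping.single as \<gamma> | as \<gamma>. as \<in> tuples (i + j) \<and> 0 \<in> set as}"

section \<open>Cochains\<close>

definition cochain_group :: "nat \<Rightarrow> ('a list \<Rightarrow> 'g::ab_group_add) monoid"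
  where "cochain_group n =
    product_group (tuples n) (\<lambda>_. \<lparr>carrier = UNIV, monoid.mult = (+), one = 0\<rparr>)"

definition linearize :: "('a list \<Rightarrow> 'g::ab_group_add) \<Rightarrow> ('a list \<Rightarrow>\<^sub>0 int) \<Rightarrow> 'g"
  where "linearize f c =
    (\<Sum>as\<in>Poly_Mapping.keys c. int_smult (Poly_Mapping.lookup c as) (f as))"

definition codh :: "('a::ab_group_add \<Rightarrow> 'a \<Rightarrow> 'a) \<Rightarrow> nat \<Rightarrow> nat \<Rightarrow>
    ('a list \<Rightarrow> 'g::ab_group_add) \<Rightarrow> ('a list \<Rightarrow> 'g)"
  where "codh dot i j f =
    (\<lambda>as\<in>tuples (i + 1 + j). linearize f (dh dot (i + 1) j (Poly_Mapping.single as 1)))"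

definition codv :: "nat \<Rightarrow> nat \<Rightarrow>
    ('a::ab_group_add list \<Rightarrow> 'g::ab_group_add) \<Rightarrow> ('a list \<Rightarrow> 'g)"
  where "codv i j f =
    (\<lambda>as\<in>tuples (i + (j + 1)). linearize f (dv i (j + 1) (Poly_Mapping.single as 1)))"

definition shuffle_cochains :: "nat \<Rightarrow> nat \<Rightarrow> ('a list \<Rightarrow> 'g::ab_group_add) set"
  where "shuffle_cochains i j =
    {f \<in> carrier (cochain_group (i + j)).
       \<forall>r as. 1 \<le> r \<longrightarrow> r \<le> j - 1 \<longrightarrow> as \<in> tuples (i + j) \<longrightarrow>
         linearize f (partial_shuffle i j r as 1) = 0}"

definition normalized_cochains :: "nat \<Rightarrow> nat \<Rightarrow> ('a::zero list \<Rightarrow> 'g::ab_group_add) set"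
  where "normalized_cochains i j =
    {f \<in> shuffle_cochains i j. \<forall>as\<in>tuples (i + j). 0 \<in> set as \<longrightarrow> f as = 0}"

end

theory Submission
  imports Defs HOL.Modules
begin

text \<open>
  Both differentials are alternating sums of faces \<open>hface\<close> and \<open>vface\<close>. The two families satisfy the
  simplicial identities (for the horizontal one these amount to the laws of a linear cycle set) and
  commute with each other, which gives the bicomplex. On a degenerate tuple the two faces adjacent
  to a vanishing entry coincide and cancel. Horizontal faces act letter by letter on the last \<open>j\<close>
  entries, so they map shuffles to shuffles; the vertical differential is a bar differential, and
  since addition is commutative, it is a derivation for the signed shuffle product. The cochain
  statements follow by duality, because the cochain groups in question are annihilators of the
  subgroups of chains.
\<close>

section \<open>Additive maps on formal linear combinations\<close>

text \<open>The sum over shuffle permutations does not lend itself to induction on letters.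
  \<open>Sh_sum_eq_shuffle_sum\<close> replaces it by a recursion that removes the letter placed
  last: the largest value of a shuffle is taken at the end of one of its two monotone blocks.
  Shuffles and bar faces are evaluated against an arbitrary function \<open>F\<close> on words
  instead of being formed as chains; a prefix, a letterwise map or another differential is then
  absorbed into \<open>F\<close>, and the Leibniz rule becomes an identity in any abelian group. The
  Leibniz rule is proved first without the face that deletes the last letter, because the other
  faces pass through the recursion and the rule then holds for empty words as well. A second
  obstacle is that a factor of length one loses its only letter, while a shuffle with an empty
  factor is not a generator of \<open>ShC\<close>; there the two deletions cancel. The chain lemmas
  are polymorphic in the coefficients: they serve \<Gamma> in the chain half and the integers in the
  cochain half.\<close>

definition alternate :: "nat \<Rightarrow> 'g \<Rightarrow> 'g::ab_group_add"
  where "alternate k x = (if even k then x else - x)"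

lemma alternate_0 [simp]: "alternate k 0 = 0"
  by (simp add: alternate_def)

lemma additive_alternate: "additive (alternate k)"
  by unfold_locales (simp add: alternate_def)

lemma alternate_alternate: "alternate k (alternate l x) = alternate (k + l) x"
  by (simp add: alternate_def)

lemma (in additive) commute_alternate: "f (alternate k x) = alternate k (f x)"
  by (simp add: alternate_def minus)

lemma int_smult_add_left: "int_smult (m + n) x = int_smult m x + int_smult n x"
proof -
  \<comment> \<open>One of the two truncated ranges in \<open>int_smult\<close> is empty; the sign
    of \<open>m\<close> decides whether the positive range grows or the negative one
    shrinks.\<close>
  have *: "int_smult (m + 1) x = int_smult m x + x" for m
  proof (cases "m \<ge> 0")
    case True
    then have "nat (m + 1) = Suc (nat m)" "nat (- m) = 0" "nat (- (m + 1)) = 0" by auto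
    then show ?thesis by (simp add: int_smult_def)
  next
    case False
    then have "nat (- m) = Suc (nat (- (m + 1)))" "nat m = 0" "nat (m + 1) = 0" by auto
    then show ?thesis by (simp add: int_smult_def)
  qed
  have **: "int_smult (m - 1) x = int_smult m x - x" for m
    using *[of "m - 1"] by (simp add: algebra_simps)
  show ?thesis
  proof (induction n rule: int_induct[where k = 0])
    case base
    then show ?case by (simp add: int_smult_def)
  next
    case (step1 i)
    then show ?case using *[of "m + i"] *[of i] by (simp add: algebra_simps)
  next
    case (step2 i)
    then show ?case using **[of "m + i"] **[of i] by (simp add: diff_add_eq_diff_diff_swap add_diff_eq)
  qed
qed

lemma int_smult_0 [simp]: "int_smult 0 x = 0"
  and int_smult_1 [simp]: "int_smult 1 x = x"
  and int_smult_minus_1 [simp]: "int_smult (- 1) x = - x"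
  and int_smult_0_right [simp]: "int_smult n 0 = 0"
  by (simp_all add: int_smult_def)

lemma int_smult_alternate: "int_smult ((- 1) ^ k) = alternate k"
  by (rule ext) (simp add: alternate_def minus_one_power_iff)

lemma additive_int_smult: "additive (int_smult n)"
  by unfold_locales (simp add: int_smult_def sum.distrib algebra_simps)

lemma (in additive) commute_int_smult: "f (int_smult n x) = int_smult n (f x)"
  by (simp add: int_smult_def diff sum)

lemma additive_compose: "additive f \<Longrightarrow> additive g \<Longrightarrow> additive (\<lambda>x. f (g x))"
  by (simp add: additive_def)

lemma additive_plus: "additive f \<Longrightarrow> additive g \<Longrightarrow> additive (\<lambda>x. f x + g x)"
  for f g :: "'a::ab_group_add \<Rightarrow> 'b::ab_group_add"
  by (simp add: additive_def algebra_simps)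

lemma additive_uminus: "additive f \<Longrightarrow> additive (\<lambda>x. - f x)"
  for f :: "'a::ab_group_add \<Rightarrow> 'b::ab_group_add"
  by (simp add: additive_def algebra_simps)

lemma additive_sum: "(\<And>k. additive (f k)) \<Longrightarrow> additive (\<lambda>x. \<Sum>k\<in>K. f k x)"
  for f :: "'k \<Rightarrow> 'a::ab_group_add \<Rightarrow> 'b::ab_group_add"
  by (simp add: additive_def sum.distrib)

text \<open>The range of summation depends on \<open>c\<close>, and cancellation can make the
  support of \<open>c + d\<close> smaller than the union of the supports. Since each
  \<open>F k\<close> maps 0 to 0, all three sums may be taken over that union.\<close>

lemma additive_sum_keys:
  fixes F :: "'k \<Rightarrow> 'g::ab_group_add \<Rightarrow> 'b::ab_group_add"
  assumes "\<And>k. additive (F k)"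
  shows "additive (\<lambda>c. \<Sum>k\<in>Poly_Mapping.keys c. F k (Poly_Mapping.lookup c k))"
proof
  fix c d :: "'k \<Rightarrow>\<^sub>0 'g"
  let ?K = "Poly_Mapping.keys c \<union> Poly_Mapping.keys d"
  have *: "(\<Sum>k\<in>Poly_Mapping.keys e. F k (Poly_Mapping.lookup e k)) =
      (\<Sum>k\<in>?K. F k (Poly_Mapping.lookup e k))" if "Poly_Mapping.keys e \<subseteq> ?K" for e
    by (rule sum.mono_neutral_left)
      (use that additive.zero[OF assms] in \<open>auto simp: in_keys_iff\<close>)
  show "(\<Sum>k\<in>Poly_Mapping.keys (c + d). F k (Poly_Mapping.lookup (c + d) k)) =
      (\<Sum>k\<in>Poly_Mapping.keys c. F k (Poly_Mapping.lookup c k)) +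
      (\<Sum>k\<in>Poly_Mapping.keys d. F k (Poly_Mapping.lookup d k))"
    using *[of "c + d", OF Poly_Mapping.keys_add] *[of c] *[of d]
    by (simp add: lookup_add additive.add[OF assms] sum.distrib)
qed

lemma additive_linear_ext: "additive (linear_ext \<phi>)"
  unfolding linear_ext_def by (rule additive_sum_keys) (simp add: additive_def single_add)

lemma linear_ext_single [simp]:
  "linear_ext \<phi> (Poly_Mapping.single as \<gamma>) = Poly_Mapping.single (\<phi> as) \<gamma>"
  by (simp add: linear_ext_def)

lemma additive_linearize: "additive (linearize f)"
  unfolding linearize_def by (rule additive_sum_keys) (simp add: additive_def int_smult_add_left)

lemma linearize_single [simp]: "linearize f (Poly_Mapping.single as n) = int_smult n (f as)"
  by (simp add: linearize_def)

lemma sum_single_keys: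
  "c = (\<Sum>k\<in>Poly_Mapping.keys c. Poly_Mapping.single k (Poly_Mapping.lookup c k))"
  by (rule poly_mapping_eqI)
    (simp add: lookup_sum lookup_single when_def sum.delta in_keys_iff)

text \<open>A subgroup of the whole additive type. No carrier is attached, so the chain groups, the
  generated subgroups and \<open>{0}\<close> in any coefficient group can all serve as targets of
  additive maps.\<close>

definition additive_closed :: "'g::ab_group_add set \<Rightarrow> bool"
  where "additive_closed S \<longleftrightarrow> 0 \<in> S \<and> (\<forall>x\<in>S. - x \<in> S) \<and> (\<forall>x\<in>S. \<forall>y\<in>S. x + y \<in> S)"

lemma additive_closed_uminus: "additive_closed S \<Longrightarrow> x \<in> S \<Longrightarrow> - x \<in> S"
  by (simp add: additive_closed_def)

lemma additive_closed_alternate: "additive_closed S \<Longrightarrow> x \<in> S \<Longrightarrow> alternate k x \<in> S"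
  by (simp add: additive_closed_def alternate_def)

lemma additive_closed_sum:
  assumes "additive_closed S" "\<And>k. k \<in> K \<Longrightarrow> f k \<in> S"
  shows "sum f K \<in> S"
  using assms(2)
  by (induction K rule: infinite_finite_induct) (use assms(1) in \<open>auto simp: additive_closed_def\<close>)

section \<open>Chain groups and generated subgroups\<close>

lemma carrier_chain_group [simp]: "carrier (chain_group n) = {c. Poly_Mapping.keys c \<subseteq> tuples n}"
  and mult_chain_group [simp]: "x \<otimes>\<^bsub>chain_group n\<^esub> y = x + y"
  and one_chain_group [simp]: "\<one>\<^bsub>chain_group n\<^esub> = 0"
  by (simp_all add: chain_group_def)

lemma comm_group_chain_group: "comm_group (chain_group n)"
proof (rule comm_groupI)
  fix x :: "'a list \<Rightarrow>\<^sub>0 'g::ab_group_add"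
  assume "x \<in> carrier (chain_group n)"
  then show "\<exists>y\<in>carrier (chain_group n). y \<otimes>\<^bsub>chain_group n\<^esub> x = \<one>\<^bsub>chain_group n\<^esub>"
    by (intro bexI[of _ "- x"]) (auto simp: keys_def)
next
  fix x y :: "'a list \<Rightarrow>\<^sub>0 'g::ab_group_add"
  assume "x \<in> carrier (chain_group n)" "y \<in> carrier (chain_group n)"
  then show "x \<otimes>\<^bsub>chain_group n\<^esub> y \<in> carrier (chain_group n)"
    using Poly_Mapping.keys_add[of x y] by auto
qed (auto simp: algebra_simps)

lemma inv_chain_group:
  assumes "x \<in> carrier (chain_group n)"
  shows "inv\<^bsub>chain_group n\<^esub> x = - x"
proof -
  interpret comm_group "chain_group n" by (rule comm_group_chain_group)
  have "- x \<in> carrier (chain_group n)" using assms by (auto simp: keys_def)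
  then show ?thesis using assms by (intro inv_equality) auto
qed

lemma additive_closed_subgroup:
  assumes "subgroup S (chain_group n)"
  shows "additive_closed S"
proof -
  have "- x \<in> S" if "x \<in> S" for x
    using subgroup.m_inv_closed[OF assms that] subgroup.mem_carrier[OF assms that]
    by (simp add: inv_chain_group)
  then show ?thesis
    using subgroup.one_closed[OF assms] subgroup.m_closed[OF assms]
    by (simp add: additive_closed_def)
qed

lemma additive_closed_chains: "additive_closed (carrier (chain_group n))"
  by (rule additive_closed_subgroup)
    (rule group.subgroup_self[OF comm_group.axioms(2)[OF comm_group_chain_group]])

lemma subgroup_generate_chains:
  "S \<subseteq> carrier (chain_group n) \<Longrightarrow> subgroup (generate (chain_group n) S) (chain_group n)"
  by (rule group.generate_is_subgroup[OF comm_group.axioms(2)[OF comm_group_chain_group]])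

text \<open>Reduces statements about \<open>ShC\<close> and \<open>CD\<close> to their generators:
  inclusions with a subgroup as \<open>T\<close>, vanishing with \<open>T = {0}\<close>.\<close>

lemma additive_image_generate:
  assumes "additive f" "S \<subseteq> carrier (chain_group n)" "additive_closed T"
    and "\<And>x. x \<in> S \<Longrightarrow> f x \<in> T" and "x \<in> generate (chain_group n) S"
  shows "f x \<in> T"
  using assms(5)
proof induction
  case one
  then show ?case using assms by (simp add: additive.zero additive_closed_def)
next
  case (incl h)
  then show ?case using assms by simp
next
  case (inv h)
  then have "inv\<^bsub>chain_group n\<^esub> h = - h" using assms(2) by (intro inv_chain_group) auto
  with inv show ?case using assms by (simp add: additive.minus additive_closed_def)
next
  case (eng h1 h2)
  then show ?case using assms by (simp add: additive.add additive_closed_def)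
qed

lemma additive_image_chains:
  assumes "additive f" "additive_closed T"
    and "\<And>as \<gamma>. as \<in> tuples n \<Longrightarrow> f (Poly_Mapping.single as \<gamma>) \<in> T"
    and "c \<in> carrier (chain_group n)"
  shows "f c \<in> T"
proof -
  have "f c = (\<Sum>k\<in>Poly_Mapping.keys c. f (Poly_Mapping.single k (Poly_Mapping.lookup c k)))"
    by (subst sum_single_keys) (rule additive.sum[OF assms(1)])
  also have "\<dots> \<in> T" using assms by (intro additive_closed_sum) auto
  finally show ?thesis .
qed

lemma additive_eq_on_chains:
  assumes "additive f" "additive g"
    and "\<And>as \<gamma>. as \<in> tuples n \<Longrightarrow> f (Poly_Mapping.single as \<gamma>) = g (Poly_Mapping.single as \<gamma>)"
    and "c \<in> carrier (chain_group n)"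
  shows "f c = g c"
proof -
  have "additive (\<lambda>c. f c + - g c)"
    by (intro additive_plus additive_uminus assms)
  then have "f c + - g c \<in> {0}"
    by (rule additive_image_chains[OF _ _ _ assms(4)])
      (use assms(3) in \<open>auto simp: additive_closed_def\<close>)
  then show ?thesis by simp
qed

section \<open>Face maps\<close>

text \<open>The three kinds of terms of \<open>dh\<close> as one family indexed by
  \<open>0..i\<close>, with sign (-1)^k. The last case also takes in \<open>k > i\<close>, so the
  length formula needs no bound on \<open>k\<close>.\<close>

definition hface :: "('a::ab_group_add \<Rightarrow> 'a \<Rightarrow> 'a) \<Rightarrow> nat \<Rightarrow> nat \<Rightarrow> 'a list \<Rightarrow> 'a list"
  where "hface dot i k as =
    (if k = 0 then act_face dot as else if k < i then add_face k as else del_face i as)"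

definition vface :: "nat \<Rightarrow> nat \<Rightarrow> nat \<Rightarrow> 'a::ab_group_add list \<Rightarrow> 'a list"
  where "vface i j k as =
    (if k = 0 then del_face (i + 1) as else if k < j then add_face (i + k) as
     else del_face (i + j) as)"

lemma sum_atMost_split_ends:
  fixes g :: "nat \<Rightarrow> 'b::comm_monoid_add"
  assumes "0 < n"
  shows "(\<Sum>k\<le>n. g k) = g 0 + (\<Sum>k=1..n-1. g k) + g n"
proof -
  obtain m where m: "n = Suc m" using assms by (cases n) auto
  have "(\<Sum>k\<le>m. g k) = g 0 + (\<Sum>k=1..m. g k)"
    by (simp add: atMost_atLeast0 sum.atLeast_Suc_atMost)
  then show ?thesis by (simp add: m)
qed

lemma dh_single:
  assumes "1 \<le> i"
  shows "dh dot i j (Poly_Mapping.single as \<gamma>) =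
    (\<Sum>k\<le>i. alternate k (Poly_Mapping.single (hface dot i k as) \<gamma>))"
proof -
  have "(\<Sum>k=1..i-1. alternate k (Poly_Mapping.single (hface dot i k as) \<gamma>)) =
      (\<Sum>k=1..i-1. alternate k (Poly_Mapping.single (add_face k as) \<gamma>))"
    by (intro sum.cong) (auto simp: hface_def)
  then show ?thesis
    using assms by (simp add: sum_atMost_split_ends dh_def int_smult_alternate)
      (simp add: hface_def alternate_def)
qed

lemma dv_single:
  assumes "1 \<le> j"
  shows "dv i j (Poly_Mapping.single as \<gamma>) =
    - (\<Sum>k\<le>j. alternate k (Poly_Mapping.single (vface i j k as) \<gamma>))"
proof -
  have "(\<Sum>k=1..j-1. alternate k (Poly_Mapping.single (vface i j k as) \<gamma>)) =
      (\<Sum>k=1..j-1. alternate k (Poly_Mapping.single (add_face (i + k) as) \<gamma>))"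
    by (intro sum.cong) (auto simp: vface_def)
  then show ?thesis
    using assms by (simp add: sum_atMost_split_ends dv_def int_smult_alternate)
      (simp add: vface_def alternate_def)
qed

lemma additive_dh: "additive (dh dot i j)"
  unfolding dh_def
  by (intro additive_plus additive_sum additive_compose[OF additive_int_smult] additive_linear_ext)

lemma additive_dv: "additive (dv i j)"
  unfolding dv_def
  by (intro additive_plus additive_sum additive_uminus additive_compose[OF additive_int_smult]
      additive_linear_ext)

section \<open>Lengths and entries of faces\<close>

lemma length_act_face [simp]: "length (act_face dot as) = length as - 1"
  by (simp add: act_face_def)

lemma nth_act_face:
  "m + 1 < length as \<Longrightarrow> act_face dot as ! m = dot (as ! 0) (as ! (m + 1))"
  by (cases as) (auto simp: act_face_def)

lemma length_add_face: "1 \<le> k \<Longrightarrow> k < length as \<Longrightarrow> length (add_face k as) = length as - 1"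
  by (simp add: add_face_def)

lemma nth_add_face:
  assumes "1 \<le> k" "k < length as" "m + 1 < length as"
  shows "add_face k as ! m =
    (if m + 1 < k then as ! m else if m + 1 = k then as ! m + as ! (m + 1) else as ! (m + 1))"
  using assms by (auto simp: add_face_def nth_append min_def nth_Cons split: nat.splits
      intro!: arg_cong[of _ _ "(!) as"])

lemma length_del_face: "1 \<le> k \<Longrightarrow> k \<le> length as \<Longrightarrow> length (del_face k as) = length as - 1"
  by (simp add: del_face_def)

lemma nth_del_face:
  assumes "1 \<le> k" "k \<le> length as" "m + 1 < length as"
  shows "del_face k as ! m = (if m + 1 < k then as ! m else as ! (m + 1))"
  using assms by (auto simp: del_face_def nth_append min_def)

lemma length_hface: "1 \<le> i \<Longrightarrow> i < length as \<Longrightarrow> length (hface dot i k as) = length as - 1"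
  by (simp add: hface_def length_add_face length_del_face)

lemma length_vface:
  "1 \<le> j \<Longrightarrow> length as = i + j \<Longrightarrow> length (vface i j k as) = length as - 1"
  by (simp add: vface_def length_add_face length_del_face)

lemma nth_hface:
  assumes "1 \<le> i" "i < length as" "k \<le> i" "m + 1 < length as"
  shows "hface dot i k as ! m =
    (if k = 0 then dot (as ! 0) (as ! (m + 1))
     else if m + 1 < k then as ! m
     else if m + 1 = k \<and> k < i then as ! m + as ! (m + 1) else as ! (m + 1))"
  using assms by (auto simp: hface_def nth_add_face nth_del_face nth_act_face)

text \<open>The third case is reached only for \<open>k = 0\<close> and \<open>m + 1 = i\<close>:
  deleting the first letter of the last block leaves the end of the first block in place.\<close>

lemma nth_vface:
  assumes "1 \<le> j" "length as = i + j" "k \<le> j" "m + 1 < length as"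
  shows "vface i j k as ! m =
    (if m + 1 < i + k then as ! m
     else if m + 1 = i + k \<and> 0 < k \<and> k < j then as ! m + as ! (m + 1)
     else if m < i then as ! m
     else as ! (m + 1))"
  using assms by (auto simp: vface_def nth_add_face nth_del_face)

text \<open>For \<open>k = l = 0\<close> this is \<open>dot_add_left\<close>: acting by a + b is
  acting by a and then by the image of b under a. For \<open>k = 0 < l < i\<close> it is
  \<open>dot_add_right\<close>, and for \<open>0 < k = l < i\<close> associativity of addition.
  Elsewhere the two faces affect separate places.\<close>

lemma hface_hface:
  assumes "linear_cycle_set dot" "Suc i < length as" "k \<le> l" "l \<le> i" "0 < i"
  shows "hface dot i k (hface dot (Suc i) (Suc l) as) = hface dot i l (hface dot (Suc i) k as)"
proof (rule nth_equalityI)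
  interpret linear_cycle_set dot by fact
  fix m assume "m < length (hface dot i k (hface dot (Suc i) (Suc l) as))"
  then have m: "Suc (Suc m) < length as" using assms by (simp add: length_hface)
  show "hface dot i k (hface dot (Suc i) (Suc l) as) ! m =
      hface dot i l (hface dot (Suc i) k as) ! m"
    by (insert assms(2-) m; cases k; cases l; rule linorder_cases[of "l" "i"];
        rule linorder_cases[of "Suc m" "k"]; rule linorder_cases[of "Suc m" "l"])
      (simp_all add: nth_hface length_hface dot_add_left dot_add_right add.assoc)
qed (use assms in \<open>simp add: length_hface\<close>)

text \<open>For \<open>0 < k = l < j\<close> both sides add the same three letters. At either end,
  adding two letters and deleting the sum agrees with deleting them one after the other.\<close>

lemma vface_vface:
  assumes "0 < j" "length as = i + Suc j" "k \<le> l" "l \<le> j"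
  shows "vface i j k (vface i (Suc j) (Suc l) as) = vface i j l (vface i (Suc j) k as)"
proof (rule nth_equalityI)
  fix m assume "m < length (vface i j k (vface i (Suc j) (Suc l) as))"
  then have m: "Suc (Suc m) < length as" using assms by (simp add: length_vface)
  show "vface i j k (vface i (Suc j) (Suc l) as) ! m = vface i j l (vface i (Suc j) k as) ! m"
    by (insert assms m; cases k; cases l; rule linorder_cases[of "l" "j"];
        rule linorder_cases[of "Suc m" "i + k"]; rule linorder_cases[of "Suc m" "i + l"])
      (simp_all add: nth_vface length_vface add.assoc)
qed (use assms in \<open>simp add: length_vface\<close>)

text \<open>The faces work on different blocks, except that the action face applies the translation
  by the first entry to the whole last block. That translation is additive, and vertical faces do
  not change the first entry.\<close>

lemma hface_vface:
  assumes "linear_cycle_set dot" "0 < j" "length as = Suc i + Suc j" "k \<le> Suc i" "l \<le> Suc j"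
  shows "hface dot (Suc i) k (vface (Suc i) (Suc j) l as) =
    vface i (Suc j) l (hface dot (Suc i) k as)"
proof (rule nth_equalityI)
  interpret linear_cycle_set dot by fact
  fix m assume "m < length (hface dot (Suc i) k (vface (Suc i) (Suc j) l as))"
  then have m: "Suc (Suc m) < length as" using assms by (simp add: length_hface length_vface)
  show "hface dot (Suc i) k (vface (Suc i) (Suc j) l as) ! m =
      vface i (Suc j) l (hface dot (Suc i) k as) ! m"
    by (insert assms(2-) m; cases k; cases l; rule linorder_cases[of "k" "Suc i"];
        rule linorder_cases[of "l" "Suc j"]; rule linorder_cases[of "Suc m" "k"];
        rule linorder_cases[of "Suc m" "i + l"])
      (simp_all add: nth_hface nth_vface length_hface length_vface dot_add_right)
qed (use assms in \<open>simp add: length_hface length_vface\<close>)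

text \<open>The index pairs with \<open>k < l\<close> are matched with those with
  \<open>l \<le> k\<close> by sending \<open>(l, k)\<close> to \<open>(k, l - 1)\<close>. Matched
  terms are equal by hypothesis, and their sign exponents differ by one.\<close>

lemma alternating_sum_simplicial:
  fixes g :: "nat \<Rightarrow> nat \<Rightarrow> 'b::ab_group_add"
  assumes "\<And>k l. k \<le> l \<Longrightarrow> l \<le> n \<Longrightarrow> g k (Suc l) = g l k"
  shows "(\<Sum>l\<le>Suc n. \<Sum>k\<le>n. alternate (l + k) (g k l)) = 0"
proof -
  have step: "g k l = g (l - 1) k" if "k < l" "l \<le> Suc n" for k l
    using assms[of k "l - 1"] that by simp
  define h where "h = (\<lambda>(l, k). alternate (l + k) (g k l))"
  define U where "U = {p. snd p < fst p \<and> fst p \<le> Suc n}"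
  define L where "L = {p. fst p \<le> snd p \<and> snd p \<le> n}"
  have fin: "finite U" "finite L"
    by (rule finite_subset[of _ "{..Suc n} \<times> {..n}"]; auto simp: U_def L_def)+
  have "(\<Sum>l\<le>Suc n. \<Sum>k\<le>n. alternate (l + k) (g k l)) = sum h ({..Suc n} \<times> {..n})"
    by (simp add: sum.cartesian_product h_def)
  also have "{..Suc n} \<times> {..n} = U \<union> L"
    by (auto simp: U_def L_def)
  also have "sum h (U \<union> L) = sum h U + sum h L"
    using fin by (intro sum.union_disjoint) (auto simp: U_def L_def)
  also have "sum h U = (\<Sum>p\<in>L. - h p)"
    by (rule sum.reindex_bij_witness[where i = "\<lambda>(k, l). (Suc l, k)" and j = "\<lambda>(l, k). (k, l - 1)"])
      (auto simp: U_def L_def h_def alternate_def step)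
  finally show ?thesis by (simp add: sum_negf)
qed

section \<open>The bicomplex identities on chains\<close>

lemma dh_dh_eq_0:
  assumes "linear_cycle_set dot" "2 \<le> i" "1 \<le> j" "c \<in> carrier (chain_group (i + j))"
  shows "dh dot (i - 1) j (dh dot i j c) = 0"
proof (rule additive_eq_on_chains[OF _ _ _ assms(4), where g = "\<lambda>_. 0"])
  fix as :: "'a list" and \<gamma> :: 'b
  assume as: "as \<in> tuples (i + j)"
  obtain n where n: "i = Suc n" "1 \<le> n" using assms(2) by (cases i) auto
  have "dh dot n j (dh dot i j (Poly_Mapping.single as \<gamma>)) =
      (\<Sum>l\<le>Suc n. \<Sum>k\<le>n. alternate (l + k)
        (Poly_Mapping.single (hface dot n k (hface dot (Suc n) l as)) \<gamma>))"
    using n by (simp add: dh_single additive.sum[OF additive_dh] additive.sum[OF additive_alternate]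
        additive.commute_alternate[OF additive_dh] alternate_alternate del: sum.atMost_Suc)
  also have "\<dots> = 0"
    by (rule alternating_sum_simplicial)
      (use as assms n in \<open>simp add: tuples_def hface_hface\<close>)
  finally show "dh dot (i - 1) j (dh dot i j (Poly_Mapping.single as \<gamma>)) = 0"
    by (simp add: n)
qed (rule additive_compose[OF additive_dh additive_dh], simp add: additive_def)

lemma dv_dv_eq_0:
  assumes "3 \<le> j" "c \<in> carrier (chain_group (i + j))"
  shows "dv i (j - 1) (dv i j c) = 0"
proof (rule additive_eq_on_chains[OF _ _ _ assms(2), where g = "\<lambda>_. 0"])
  fix as :: "'a list" and \<gamma> :: 'b
  assume as: "as \<in> tuples (i + j)"
  obtain n where n: "j = Suc n" "2 \<le> n" using assms(1) by (cases j) auto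
  \<comment> \<open>The two overall minus signs of the vertical differential cancel.\<close>
  have "dv i n (dv i j (Poly_Mapping.single as \<gamma>)) =
      (\<Sum>l\<le>Suc n. \<Sum>k\<le>n. alternate (l + k)
        (Poly_Mapping.single (vface i n k (vface i (Suc n) l as)) \<gamma>))"
    using n by (simp add: dv_single additive.sum[OF additive_dv] additive.sum[OF additive_alternate]
        additive.commute_alternate[OF additive_dv] alternate_alternate additive.minus[OF additive_dv]
        additive.minus[OF additive_alternate] sum_negf del: sum.atMost_Suc)
  also have "\<dots> = 0"
    by (rule alternating_sum_simplicial)
      (use as assms n in \<open>simp add: tuples_def vface_vface\<close>)
  finally show "dv i (j - 1) (dv i j (Poly_Mapping.single as \<gamma>)) = 0"
    by (simp add: n)
qed (rule additive_compose[OF additive_dv additive_dv], simp add: additive_def)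

lemma dh_dv_commute:
  assumes "linear_cycle_set dot" "1 \<le> i" "2 \<le> j" "c \<in> carrier (chain_group (i + j))"
  shows "dh dot i (j - 1) (dv i j c) = dv (i - 1) j (dh dot i j c)"
proof (rule additive_eq_on_chains[OF _ _ _ assms(4)])
  fix as :: "'a list" and \<gamma> :: 'b
  assume as: "as \<in> tuples (i + j)"
  obtain m n where n: "i = Suc m" "j = Suc n" "0 < n" 
    using assms(2,3) by (cases i; cases j) auto
  have "dh dot i (j - 1) (dv i j (Poly_Mapping.single as \<gamma>)) =
      - (\<Sum>l\<le>j. \<Sum>k\<le>i. alternate (l + k)
        (Poly_Mapping.single (hface dot i k (vface i j l as)) \<gamma>))"
    using assms(2,3)
    by (simp add: dv_single dh_single additive.sum[OF additive_dh] additive.minus[OF additive_dh]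
        additive.commute_alternate[OF additive_dh] additive.sum[OF additive_alternate]
        alternate_alternate)
  also have "(\<Sum>l\<le>j. \<Sum>k\<le>i. alternate (l + k)
        (Poly_Mapping.single (hface dot i k (vface i j l as)) \<gamma>)) =
      (\<Sum>l\<le>j. \<Sum>k\<le>i. alternate (l + k)
        (Poly_Mapping.single (vface (i - 1) j l (hface dot i k as)) \<gamma>))"
    by (intro sum.cong refl) (use as assms n in \<open>simp add: tuples_def hface_vface\<close>)
  also have "\<dots> = (\<Sum>k\<le>i. \<Sum>l\<le>j. alternate (k + l)
        (Poly_Mapping.single (vface (i - 1) j l (hface dot i k as)) \<gamma>))"
    by (subst sum.swap) (simp add: add.commute)
  also have "- \<dots> = dv (i - 1) j (dh dot i j (Poly_Mapping.single as \<gamma>))"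
    using assms(2,3)
    by (simp add: dv_single dh_single additive.sum[OF additive_dv] additive.minus[OF additive_alternate]
        additive.commute_alternate[OF additive_dv] additive.sum[OF additive_alternate]
        alternate_alternate sum_negf)
  finally show "dh dot i (j - 1) (dv i j (Poly_Mapping.single as \<gamma>)) =
      dv (i - 1) j (dh dot i j (Poly_Mapping.single as \<gamma>))" .
qed (rule additive_compose[OF additive_dh additive_dv] additive_compose[OF additive_dv additive_dh])+

lemma dh_closed:
  assumes "1 \<le> i" "1 \<le> j" "c \<in> carrier (chain_group (i + j))"
  shows "dh dot i j c \<in> carrier (chain_group (i - 1 + j))"
proof (rule additive_image_chains[OF additive_dh additive_closed_chains _ assms(3)])
  fix as :: "'a list" and \<gamma> :: 'b
  assume "as \<in> tuples (i + j)"
  then show "dh dot i j (Poly_Mapping.single as \<gamma>) \<in> carrier (chain_group (i - 1 + j))"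
    using assms unfolding dh_single[OF assms(1)]
    by (intro additive_closed_sum additive_closed_alternate additive_closed_chains)
      (simp add: tuples_def length_hface)
qed

lemma dv_closed:
  assumes "2 \<le> j" "c \<in> carrier (chain_group (i + j))"
  shows "dv i j c \<in> carrier (chain_group (i + (j - 1)))"
proof (rule additive_image_chains[OF additive_dv additive_closed_chains _ assms(2)])
  fix as :: "'a list" and \<gamma> :: 'b
  assume as: "as \<in> tuples (i + j)"
  have "(\<Sum>k\<le>j. alternate k (Poly_Mapping.single (vface i j k as) \<gamma>)) \<in>
      carrier (chain_group (i + (j - 1)))"
    by (intro additive_closed_sum additive_closed_alternate additive_closed_chains)
      (use assms as in \<open>simp add: tuples_def length_vface\<close>)
  then show "dv i j (Poly_Mapping.single as \<gamma>) \<in> carrier (chain_group (i + (j - 1)))"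
    using assms additive_closed_chains by (simp add: dv_single additive_closed_def)
qed

section \<open>Degenerate tuples\<close>

lemma CD_generators: "as \<in> tuples (i + j) \<Longrightarrow> 0 \<in> set as \<Longrightarrow> Poly_Mapping.single as \<gamma> \<in> CD i j"
  unfolding CD_def by (rule generate.incl) blast

lemma CD_generators_closed:
  "{Poly_Mapping.single as \<gamma> | as \<gamma>. as \<in> tuples (i + j) \<and> 0 \<in> set as} \<subseteq>
    carrier (chain_group (i + j))"
  by (auto split: if_splits)

lemma subgroup_CD: "subgroup (CD i j) (chain_group (i + j))"
  unfolding CD_def by (rule subgroup_generate_chains[OF CD_generators_closed])

text \<open>A vanishing entry makes two neighbouring faces equal; they cancel.\<close>

lemma alternating_sum_mem:
  assumes "additive_closed S" "\<And>k. k \<le> n \<Longrightarrow> k \<noteq> m \<Longrightarrow> k \<noteq> Suc m \<Longrightarrow> g k \<in> S"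
    and "m < n \<Longrightarrow> g m = g (Suc m)" "m \<noteq> n"
  shows "(\<Sum>k\<le>n. alternate k (g k)) \<in> S"
proof (cases "m < n")
  case True
  have "(\<Sum>k\<le>n. alternate k (g k)) =
      (\<Sum>k\<in>{..n} - {m, Suc m}. alternate k (g k)) + (\<Sum>k\<in>{m, Suc m}. alternate k (g k))"
    using True by (intro sum.subset_diff) auto
  also have "(\<Sum>k\<in>{m, Suc m}. alternate k (g k)) = 0"
    using assms(3)[OF True] by (simp add: alternate_def)
  finally show ?thesis
    using assms(1,2) by (auto intro!: additive_closed_sum additive_closed_alternate)
next
  case False
  then show ?thesis
    using assms by (intro additive_closed_sum additive_closed_alternate) auto
qed

text \<open>By \<open>dot_add_left\<close>, the translation by 0 is idempotent; being bijective, it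
  is the identity. This is where bijectivity of translations enters.\<close>

lemma dot_0:
  assumes "linear_cycle_set dot"
  shows dot_0_right: "dot a 0 = 0" and dot_0_left: "dot 0 a = a"
proof -
  interpret linear_cycle_set dot by fact
  show *: "dot b 0 = 0" for b using dot_add_right[of b 0 0] by simp
  have "dot 0 a = dot 0 (dot 0 a)" using dot_add_left[of 0 0 a] by (simp add: *)
  with bij_dot[of 0] show "dot 0 a = a" by (metis bij_pointE)
qed

text \<open>A zero at index \<open>m\<close> of the first block is affected only by the faces
  \<open>m\<close> and \<open>m + 1\<close>. A zero in the last block survives every horizontal
  face, the action face included, because translations fix 0.\<close>

lemma hface_degenerate:
  assumes "linear_cycle_set dot" "1 \<le> i" "i < length as" "k \<le> i"
    and "m < length as" "as ! m = 0" "m < i \<Longrightarrow> k \<noteq> m \<and> k \<noteq> Suc m"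
  shows "0 \<in> set (hface dot i k as)"
proof -
  \<comment> \<open>The place of the surviving zero: faces of index at most \<open>m\<close> shift
    it one place to the left.\<close>
  define n where "n = (if k \<le> m then m - 1 else m)"
  have n: "n + 1 < length as" "n < length (hface dot i k as)"
    using assms by (auto simp: n_def length_hface)
  have "hface dot i k as ! n = 0"
    using assms n by (auto simp: n_def nth_hface dot_0_right)
  with n show ?thesis by (metis nth_mem)
qed

text \<open>Merging a zero with its left or right neighbour just removes it. The end faces fit in:
  the action of 0 is trivial, and the last face deletes the zero itself.\<close>

lemma hface_zero_entry:
  assumes "linear_cycle_set dot" "i < length as" "m < i" "as ! m = 0"
  shows "hface dot i m as = hface dot i (Suc m) as"
proof (rule nth_equalityI)
  fix p assume "p < length (hface dot i m as)"
  then have p: "p + 1 < length as" using assms by (simp add: length_hface)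
  show "hface dot i m as ! p = hface dot i (Suc m) as ! p"
    by (insert assms p; cases m; rule linorder_cases[of p m]; rule linorder_cases[of "Suc p" m])
      (simp_all add: nth_hface dot_0_left)
qed (use assms in \<open>simp add: length_hface\<close>)

lemma vface_degenerate:
  assumes "2 \<le> j" "length as = i + j" "k \<le> j"
    and "m < length as" "as ! m = 0" "i \<le> m \<Longrightarrow> i + k \<noteq> m \<and> i + k \<noteq> Suc m"
  shows "0 \<in> set (vface i j k as)"
proof -
  define n where "n = (if i + k \<le> m then m - 1 else m)"
  have n: "n + 1 < length as" "n < length (vface i j k as)"
    using assms by (cases "i \<le> m"; auto simp: n_def length_vface)+
  have "vface i j k as ! n = 0"
    using assms n by (auto simp: n_def nth_vface)
  with n show ?thesis by (metis nth_mem)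
qed

lemma vface_zero_entry:
  assumes "length as = i + j" "m < j" "as ! (i + m) = 0"
  shows "vface i j m as = vface i j (Suc m) as"
proof (rule nth_equalityI)
  fix p assume "p < length (vface i j m as)"
  then have p: "p + 1 < length as" using assms by (simp add: length_vface)
  show "vface i j m as ! p = vface i j (Suc m) as ! p"
    by (insert assms p; cases m; rule linorder_cases[of p "i + m"];
        rule linorder_cases[of "Suc p" "i + m"]) (simp_all add: nth_vface)
qed (use assms in \<open>simp add: length_vface\<close>)

lemma dh_CD:
  assumes "linear_cycle_set dot" "1 \<le> i" "1 \<le> j" "c \<in> CD i j"
  shows "dh dot i j c \<in> CD (i - 1) j"
proof (rule additive_image_generate[OF additive_dh CD_generators_closed
      additive_closed_subgroup[OF subgroup_CD] _ assms(4)[unfolded CD_def]])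
  fix x :: "'a list \<Rightarrow>\<^sub>0 'b"
  assume "x \<in> {Poly_Mapping.single as \<gamma> | as \<gamma>. as \<in> tuples (i + j) \<and> 0 \<in> set as}"
  then obtain as \<gamma> m where x: "x = Poly_Mapping.single as \<gamma>" "length as = i + j"
      "m < length as" "as ! m = 0"
    by (auto simp: tuples_def in_set_conv_nth)
  have "(\<Sum>k\<le>i. alternate k (Poly_Mapping.single (hface dot i k as) \<gamma>)) \<in> CD (i - 1) j"
  proof (cases "m < i")
    case True
    show ?thesis
    proof (rule alternating_sum_mem[where m = m, OF additive_closed_subgroup[OF subgroup_CD]])
      fix k assume "k \<le> i" "k \<noteq> m" "k \<noteq> Suc m"
      then show "Poly_Mapping.single (hface dot i k as) \<gamma> \<in> CD (i - 1) j"
        using assms x by (intro CD_generators hface_degenerate[where m = m])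
          (auto simp: tuples_def length_hface)
    qed (use True assms x in \<open>simp_all add: hface_zero_entry[where m = m]\<close>)
  next
    \<comment> \<open>The zero lies in the last block, so each term is degenerate by itself and no
      cancellation occurs.\<close>
    case False
    show ?thesis
    proof (intro additive_closed_sum additive_closed_alternate additive_closed_subgroup[OF subgroup_CD])
      fix k assume "k \<in> {..i}"
      then show "Poly_Mapping.single (hface dot i k as) \<gamma> \<in> CD (i - 1) j"
        using assms x False 
        by (intro CD_generators hface_degenerate[where m = m])
          (auto simp: tuples_def length_hface)
    qed
  qed
  then show "dh dot i j x \<in> CD (i - 1) j" using assms x by (simp add: dh_single)
qed

lemma dv_CD:
  assumes "2 \<le> j" "c \<in> CD i j"
  shows "dv i j c \<in> CD i (j - 1)"
proof (rule additive_image_generate[OF additive_dv CD_generators_closed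
      additive_closed_subgroup[OF subgroup_CD] _ assms(2)[unfolded CD_def]])
  fix x :: "'a list \<Rightarrow>\<^sub>0 'b"
  assume "x \<in> {Poly_Mapping.single as \<gamma> | as \<gamma>. as \<in> tuples (i + j) \<and> 0 \<in> set as}"
  then obtain as \<gamma> m where x: "x = Poly_Mapping.single as \<gamma>" "length as = i + j"
      "m < length as" "as ! m = 0"
    by (auto simp: tuples_def in_set_conv_nth)
  have "(\<Sum>k\<le>j. alternate k (Poly_Mapping.single (vface i j k as) \<gamma>)) \<in> CD i (j - 1)"
  proof (cases "i \<le> m")
    case True
    show ?thesis
    proof (rule alternating_sum_mem[where m = "m - i", OF additive_closed_subgroup[OF subgroup_CD]])
      fix k assume "k \<le> j" "k \<noteq> m - i" "k \<noteq> Suc (m - i)"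
      then show "Poly_Mapping.single (vface i j k as) \<gamma> \<in> CD i (j - 1)"
        using assms x True by (intro CD_generators vface_degenerate[where m = m])
          (auto simp: tuples_def length_vface)
    qed (use True assms x in \<open>simp_all add: vface_zero_entry[where m = "m - i"]\<close>)
  next
    case False
    show ?thesis
    proof (intro additive_closed_sum additive_closed_alternate additive_closed_subgroup[OF subgroup_CD])
      fix k assume "k \<in> {..j}"
      then show "Poly_Mapping.single (vface i j k as) \<gamma> \<in> CD i (j - 1)"
        using assms x False 
        by (intro CD_generators vface_degenerate[where m = m])
          (auto simp: tuples_def length_vface)
    qed
  qed
  from additive_closed_uminus[OF additive_closed_subgroup[OF subgroup_CD] this]
  show "dv i j x \<in> CD i (j - 1)"
    using assms by (simp add: x dv_single)
qed

section \<open>The signed shuffle sum\<close>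

text \<open>
  Words are read from right to left here, because a shuffle is decomposed according to its last
  letter, which keeps the remaining positions in place.
\<close>

fun shuffle_sum :: "'a list \<Rightarrow> 'a list \<Rightarrow> ('a list \<Rightarrow> 'b) \<Rightarrow> 'b::ab_group_add"
  where
    "shuffle_sum [] [] F = F []"
  | "shuffle_sum [] (y # ys) F = shuffle_sum [] ys (\<lambda>w. F (y # w))"
  | "shuffle_sum (x # xs) [] F = shuffle_sum xs [] (\<lambda>w. F (x # w))"
  | "shuffle_sum (x # xs) (y # ys) F = shuffle_sum (x # xs) ys (\<lambda>w. F (y # w)) +
      alternate (Suc (length ys)) (shuffle_sum xs (y # ys) (\<lambda>w. F (x # w)))"

lemma shuffle_sum_Nil [simp]: "shuffle_sum [] ys F = F ys"
  by (induction ys arbitrary: F) auto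

lemma shuffle_sum_Nil2 [simp]: "shuffle_sum xs [] F = F xs"
  by (induction xs arbitrary: F) auto

lemma shuffle_sum_cong:
  assumes "\<And>w. length w = length xs + length ys \<Longrightarrow> F w = G w"
  shows "shuffle_sum xs ys F = shuffle_sum xs ys G"
  using assms
proof (induction xs ys F arbitrary: G rule: shuffle_sum.induct)
  case (4 x xs y ys F)
  have "shuffle_sum (x # xs) ys (\<lambda>w. F (y # w)) = shuffle_sum (x # xs) ys (\<lambda>w. G (y # w))"
    by (rule "4.IH"(1)) (simp add: "4.prems")
  moreover have "shuffle_sum xs (y # ys) (\<lambda>w. F (x # w)) = shuffle_sum xs (y # ys) (\<lambda>w. G (x # w))"
    by (rule "4.IH"(2)) (simp add: "4.prems")
  ultimately show ?case by simp
qed auto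

lemma shuffle_sum_add:
  "shuffle_sum xs ys (\<lambda>w. F w + G w) = shuffle_sum xs ys F + shuffle_sum xs ys G"
  by (induction xs ys F arbitrary: G rule: shuffle_sum.induct)
    (simp_all add: additive.add[OF additive_alternate] add.assoc add.left_commute)

lemma (in additive) shuffle_sum: "f (shuffle_sum xs ys F) = shuffle_sum xs ys (\<lambda>w. f (F w))"
  by (induction xs ys F rule: shuffle_sum.induct) (simp_all add: add commute_alternate)

lemma shuffle_sum_alternate:
  "shuffle_sum xs ys (\<lambda>w. alternate k (F w)) = alternate k (shuffle_sum xs ys F)"
  by (simp add: additive.shuffle_sum[OF additive_alternate])

lemma shuffle_sum_map:
  "shuffle_sum (map g xs) (map g ys) F = shuffle_sum xs ys (\<lambda>w. F (map g w))"
  by (induction xs ys "\<lambda>w. F (map g w)" arbitrary: F rule: shuffle_sum.induct) simp_all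

section \<open>Shuffle permutations\<close>

text \<open>The cycle that carries the last place of a first block of length \<open>r + 1\<close>
  past the \<open>s\<close> places of the second block. Precomposing with it turns shuffles in
  \<open>Sh r s\<close> into those shuffles in \<open>Sh (Suc r) s\<close> that put the last letter
  of the first block at the very end.\<close>

definition cycle_up :: "nat \<Rightarrow> nat \<Rightarrow> nat \<Rightarrow> nat"
  where "cycle_up r s k =
    (if k = r + 1 then r + 1 + s else if r + 1 < k \<and> k \<le> r + 1 + s then k - 1 else k)"

definition cycle_down :: "nat \<Rightarrow> nat \<Rightarrow> nat \<Rightarrow> nat"
  where "cycle_down r s k =
    (if k = r + 1 + s then r + 1 else if r < k \<and> k \<le> r + s then k + 1 else k)"

lemma cycle_down_up: "cycle_down r s \<circ> cycle_up r s = id"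
  and cycle_up_down: "cycle_up r s \<circ> cycle_down r s = id"
  by (auto simp: fun_eq_iff cycle_up_def cycle_down_def)

lemma bij_cycle_up: "bij (cycle_up r s)"
  and bij_cycle_down: "bij (cycle_down r s)"
  using o_bij[OF cycle_down_up cycle_up_down] o_bij[OF cycle_up_down cycle_down_up] by auto

lemma inv_cycle_up: "inv_into UNIV (cycle_up r s) = cycle_down r s"
  by (rule inv_unique_comp[OF cycle_up_down cycle_down_up])

lemma cycle_up_permutes: "cycle_up r s permutes {1..Suc r + s}"
  by (simp add: permutes_def bij_iff[symmetric] bij_cycle_up) (simp add: cycle_up_def)

lemma cycle_down_permutes: "cycle_down r s permutes {1..Suc r + s}"
  by (simp add: permutes_def bij_iff[symmetric] bij_cycle_down) (simp add: cycle_down_def)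

lemma sign_cycle_up: "sign (cycle_up r s) = (- 1) ^ s"
proof (induction s)
  case 0
  have "cycle_up r 0 = id" by (auto simp: cycle_up_def)
  then show ?case by simp
next
  case (Suc s)
  \<comment> \<open>Passing one more place costs one adjacent transposition, hence one sign.\<close>
  have "cycle_up r (Suc s) = Transposition.transpose (r + 1 + s) (r + 2 + s) \<circ> cycle_up r s"
    by (auto simp: fun_eq_iff cycle_up_def Transposition.transpose_def)
  moreover have "permutation (cycle_up r s)"
    using cycle_up_permutes by (rule permutes_imp_permutation[rotated]) simp
  ultimately have "sign (cycle_up r (Suc s)) =
      sign (Transposition.transpose (r + 1 + s) (r + 2 + s)) * sign (cycle_up r s)"
    using sign_compose[OF permutation_swap_id] by metis
  then show ?case
    using Suc by (simp add: sign_swap_id)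
qed

lemma Sh_finite: "finite (Sh r s)"
  by (rule finite_subset[OF _ finite_permutations[of "{1..r + s}"]]) (auto simp: Sh_def)

lemma Sh_permutation: "\<sigma> \<in> Sh r s \<Longrightarrow> permutation \<sigma>"
  unfolding Sh_def by (auto intro: permutes_imp_permutation[rotated])

lemma Sh_0_0: "Sh 0 0 = {id}"
  by (auto simp: Sh_def mono_on_def)

text \<open>An equality of sets of functions, without renumbering: a permutation of an initial
  segment is the identity beyond it, so fixing the largest point is the same as permuting the
  shorter segment. This is the advantage of splitting off the last letter.\<close>

lemma Sh_last_right: "{\<sigma> \<in> Sh r (Suc s). \<sigma> (Suc (r + s)) = Suc (r + s)} = Sh r s"
proof (intro equalityI subsetI)
  fix \<sigma> assume \<sigma>: "\<sigma> \<in> {\<sigma> \<in> Sh r (Suc s). \<sigma> (Suc (r + s)) = Suc (r + s)}"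
  then have "\<sigma> permutes {1..Suc (r + s)}" by (simp add: Sh_def)
  then have "\<sigma> permutes {1..r + s}"
  proof (rule permutes_superset)
    fix x assume "x \<in> {1..Suc (r + s)} - {1..r + s}"
    then have "x = Suc (r + s)" by auto
    with \<sigma> show "\<sigma> x = x" by simp
  qed
  with \<sigma> show "\<sigma> \<in> Sh r s"
    by (auto simp: Sh_def intro: mono_on_subset)
next
  fix \<sigma> assume "\<sigma> \<in> Sh r s"
  then have \<sigma>: "\<sigma> permutes {1..r + s}" "mono_on {1..r} \<sigma>" "mono_on {r + 1..r + s} \<sigma>"
    by (auto simp: Sh_def)
  have last: "\<sigma> (Suc (r + s)) = Suc (r + s)"
    by (rule permutes_not_in[OF \<sigma>(1)]) simp
  have le: "\<sigma> k \<le> r + s" if "k \<le> r + s" for k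
    using permutes_in_image[OF \<sigma>(1), of k] permutes_not_in[OF \<sigma>(1), of k] that by fastforce
  have "mono_on {r + 1..r + Suc s} \<sigma>"
  proof (rule mono_onI)
    fix k l assume "k \<in> {r + 1..r + Suc s}" "l \<in> {r + 1..r + Suc s}" "k \<le> l"
    then show "\<sigma> k \<le> \<sigma> l"
      using mono_onD[OF \<sigma>(3), of k l] last le[of k]
      by (cases "l = Suc (r + s)"; cases "k = Suc (r + s)"; force)
  qed
  then show "\<sigma> \<in> {\<sigma> \<in> Sh r (Suc s). \<sigma> (Suc (r + s)) = Suc (r + s)}"
    using \<sigma> last permutes_subset[OF \<sigma>(1), of "{1..r + Suc s}"] by (auto simp: Sh_def)
qed

text \<open>Inserting the largest value at the end of the first block preserves monotonicity there;
  on the second block the cycle only shifts the arguments by one. The inverse map composes with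
  \<open>cycle_down\<close>.\<close>

lemma Sh_last_left:
  "bij_betw (\<lambda>\<tau>. \<tau> \<circ> cycle_up r s) (Sh r s)
    {\<sigma> \<in> Sh (Suc r) s. \<sigma> (Suc r) = Suc (r + s)}"
proof (rule bij_betw_byWitness[where f' = "\<lambda>\<sigma>. \<sigma> \<circ> cycle_down r s"])
  show "(\<lambda>\<tau>. \<tau> \<circ> cycle_up r s) ` Sh r s \<subseteq> {\<sigma> \<in> Sh (Suc r) s. \<sigma> (Suc r) = Suc (r + s)}"
  proof (intro image_subsetI CollectI conjI)
    fix \<tau> assume "\<tau> \<in> Sh r s"
    then have \<tau>: "\<tau> permutes {1..r + s}" "mono_on {1..r} \<tau>" "mono_on {r + 1..r + s} \<tau>"
      by (auto simp: Sh_def)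
    have last: "\<tau> (Suc (r + s)) = Suc (r + s)"
      by (rule permutes_not_in[OF \<tau>(1)]) simp
    then show *: "(\<tau> \<circ> cycle_up r s) (Suc r) = Suc (r + s)"
      by (simp add: cycle_up_def)
    have le: "\<tau> k \<le> r + s" if "k \<le> r + s" for k
      using permutes_in_image[OF \<tau>(1), of k] permutes_not_in[OF \<tau>(1), of k] that by fastforce
    have "\<tau> \<circ> cycle_up r s permutes {1..Suc r + s}"
      by (rule permutes_compose[OF cycle_up_permutes permutes_subset[OF \<tau>(1)]]) auto
    moreover have "mono_on {1..Suc r} (\<tau> \<circ> cycle_up r s)"
    proof (rule mono_onI)
      fix k l assume "k \<in> {1..Suc r}" "l \<in> {1..Suc r}" "k \<le> l"
      then show "(\<tau> \<circ> cycle_up r s) k \<le> (\<tau> \<circ> cycle_up r s) l"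
        using mono_onD[OF \<tau>(2), of k l] last le[of k]
        by (cases "l = Suc r"; cases "k = Suc r"; simp add: cycle_up_def)
    qed
    moreover have "mono_on {Suc r + 1..Suc r + s} (\<tau> \<circ> cycle_up r s)"
    proof (rule mono_onI)
      fix k l assume "k \<in> {Suc r + 1..Suc r + s}" "l \<in> {Suc r + 1..Suc r + s}" "k \<le> l"
      then show "(\<tau> \<circ> cycle_up r s) k \<le> (\<tau> \<circ> cycle_up r s) l"
        using mono_onD[OF \<tau>(3), of "k - 1" "l - 1"] by (auto simp: cycle_up_def)
    qed
    ultimately show "\<tau> \<circ> cycle_up r s \<in> Sh (Suc r) s" by (simp add: Sh_def)
  qed
  show "(\<lambda>\<sigma>. \<sigma> \<circ> cycle_down r s) ` {\<sigma> \<in> Sh (Suc r) s. \<sigma> (Suc r) = Suc (r + s)} \<subseteq> Sh r s"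
  proof (intro image_subsetI)
    fix \<sigma> assume "\<sigma> \<in> {\<sigma> \<in> Sh (Suc r) s. \<sigma> (Suc r) = Suc (r + s)}"
    then have \<sigma>: "\<sigma> permutes {1..Suc r + s}" "mono_on {1..Suc r} \<sigma>"
        "mono_on {Suc r + 1..Suc r + s} \<sigma>" "\<sigma> (Suc r) = Suc (r + s)"
      by (auto simp: Sh_def)
    have "\<sigma> \<circ> cycle_down r s permutes {1..r + s}"
      by (rule permutes_superset[OF permutes_compose[OF cycle_down_permutes \<sigma>(1)]])
        (auto simp: \<sigma>(4) cycle_down_def)
    moreover have "mono_on {1..r} (\<sigma> \<circ> cycle_down r s)"
    proof (rule mono_onI)
      fix k l assume "k \<in> {1..r}" "l \<in> {1..r}" "k \<le> l"
      then show "(\<sigma> \<circ> cycle_down r s) k \<le> (\<sigma> \<circ> cycle_down r s) l"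
        using mono_onD[OF \<sigma>(2), of k l] by (auto simp: cycle_down_def)
    qed
    moreover have "mono_on {r + 1..r + s} (\<sigma> \<circ> cycle_down r s)"
    proof (rule mono_onI)
      fix k l assume "k \<in> {r + 1..r + s}" "l \<in> {r + 1..r + s}" "k \<le> l"
      then show "(\<sigma> \<circ> cycle_down r s) k \<le> (\<sigma> \<circ> cycle_down r s) l"
        using mono_onD[OF \<sigma>(3), of "k + 1" "l + 1"] by (auto simp: cycle_down_def)
    qed
    ultimately show "\<sigma> \<circ> cycle_down r s \<in> Sh r s" by (simp add: Sh_def)
  qed
qed (simp_all add: comp_assoc cycle_up_down cycle_down_up)

text \<open>By monotonicity the largest value is taken at the end of a block; by injectivity this
  happens for only one of them. Inequality of truth values is exclusive or. The guard
  \<open>0 < s\<close> matters: for an empty second block both equations coincide.\<close>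

lemma Sh_last_cases:
  assumes "\<sigma> \<in> Sh r s" "0 < r + s"
  shows "(0 < r \<and> \<sigma> r = r + s) \<noteq> (0 < s \<and> \<sigma> (r + s) = r + s)"
proof -
  have \<sigma>: "\<sigma> permutes {1..r + s}" "mono_on {1..r} \<sigma>" "mono_on {r + 1..r + s} \<sigma>"
    using assms(1) by (auto simp: Sh_def)
  obtain m where m: "m \<in> {1..r + s}" "\<sigma> m = r + s"
    using permutes_image[OF \<sigma>(1)] assms(2)
    by (metis atLeastAtMost_iff imageE le_refl less_eq_Suc_le One_nat_def)
  have le: "\<sigma> k \<le> r + s" if "k \<in> {1..r + s}" for k
    using permutes_in_image[OF \<sigma>(1), of k] that by fastforce
  have "\<sigma> r = r + s" if "m \<le> r"
    using mono_onD[OF \<sigma>(2), of m r] m le[of r] that by force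
  moreover have "\<sigma> (r + s) = r + s" if "r < m"
    using mono_onD[OF \<sigma>(3), of m "r + s"] m le[of "r + s"] that by force
  ultimately have "(0 < r \<and> \<sigma> r = r + s) \<or> (0 < s \<and> \<sigma> (r + s) = r + s)"
    using m(1) by (cases "m \<le> r") auto
  moreover have "\<not> (0 < s \<and> \<sigma> r = r + s \<and> \<sigma> (r + s) = r + s)"
    using permutes_inj[OF \<sigma>(1)] by (metis add.right_neutral add_left_cancel inj_eq less_irrefl)
  ultimately show ?thesis by auto
qed

text \<open>Because of the inverse, the letter at place \<open>k\<close> moves to place
  \<open>\<sigma> k\<close>; the largest value of \<open>\<sigma>\<close> thus marks the letter that
  comes last.\<close>

definition permute_word :: "(nat \<Rightarrow> nat) \<Rightarrow> 'a list \<Rightarrow> 'a list"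
  where "permute_word \<sigma> as = map (\<lambda>k. as ! (inv_into UNIV \<sigma> k - 1)) [1..<length as + 1]"

lemma permute_word_last_right:
  assumes "\<sigma> permutes {1..length as}"
  shows "permute_word \<sigma> (as @ [a]) = permute_word \<sigma> as @ [a]"
proof -
  have inv: "inv_into UNIV \<sigma> permutes {1..length as}" using assms by (rule permutes_inv)
  have "inv_into UNIV \<sigma> (Suc (length as)) = Suc (length as)"
    by (rule permutes_not_in[OF inv]) simp
  moreover have "(as @ [a]) ! (inv_into UNIV \<sigma> k - 1) = as ! (inv_into UNIV \<sigma> k - 1)" if "k \<in> {1..length as}" for k
    using permutes_in_image[OF inv, of k] that by (auto simp: nth_append)
  ultimately show ?thesis by (auto simp: permute_word_def)
qed

lemma permute_word_last_left:
  assumes "\<tau> permutes {1..length as + length bs}"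
  shows "permute_word (\<tau> \<circ> cycle_up (length as) (length bs)) (as @ a # bs) =
    permute_word \<tau> (as @ bs) @ [a]"
proof -
  let ?r = "length as" and ?s = "length bs"
  have inv: "inv_into UNIV \<tau> permutes {1..?r + ?s}" using assms by (rule permutes_inv)
  have comp: "inv_into UNIV (\<tau> \<circ> cycle_up ?r ?s) = cycle_down ?r ?s \<circ> inv_into UNIV \<tau>"
    using o_inv_distrib[OF permutes_bij[OF assms] bij_cycle_up] by (simp add: inv_cycle_up)
  have "inv_into UNIV \<tau> (Suc (?r + ?s)) = Suc (?r + ?s)"
    by (rule permutes_not_in[OF inv]) simp
  then have "(as @ a # bs) ! (cycle_down ?r ?s (inv_into UNIV \<tau> (Suc (?r + ?s))) - 1) = a"
    by (simp add: cycle_down_def nth_append)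
  moreover have "(as @ a # bs) ! (cycle_down ?r ?s (inv_into UNIV \<tau> k) - 1) = (as @ bs) ! (inv_into UNIV \<tau> k - 1)"
    if "k \<in> {1..?r + ?s}" for k
    using permutes_in_image[OF inv, of k] that
    by (auto simp: cycle_down_def nth_append nth_Cons split: nat.splits intro!: arg_cong[of _ _ "(!) bs"])
  ultimately show ?thesis by (auto simp: permute_word_def comp)
qed

definition Sh_sum :: "nat \<Rightarrow> nat \<Rightarrow> 'a list \<Rightarrow> ('a list \<Rightarrow> 'b) \<Rightarrow> 'b::ab_group_add"
  where "Sh_sum r s as F = (\<Sum>\<sigma>\<in>Sh r s. int_smult (sign \<sigma>) (F (permute_word \<sigma> as)))"

lemma sum_Sh_last_right:
  assumes "length as = r + s"
  shows "(\<Sum>\<sigma> | \<sigma> \<in> Sh r (Suc s) \<and> \<sigma> (Suc (r + s)) = Suc (r + s).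
      int_smult (sign \<sigma>) (F (permute_word \<sigma> (as @ [a])))) = Sh_sum r s as (\<lambda>w. F (w @ [a]))"
  unfolding Sh_sum_def Sh_last_right using assms
  by (intro sum.cong refl) (simp add: Sh_def permute_word_last_right)

text \<open>To come last, the letter \<open>a\<close> has to pass all of \<open>bs\<close>, which
  accounts for the sign; the remaining permutation shuffles \<open>as\<close> with
  \<open>bs\<close>.\<close>

lemma sum_Sh_last_left:
  fixes F :: "'a list \<Rightarrow> 'b::ab_group_add"
  shows
  "(\<Sum>\<sigma> | \<sigma> \<in> Sh (Suc (length as)) (length bs) \<and>
        \<sigma> (Suc (length as)) = Suc (length as + length bs).
      int_smult (sign \<sigma>) (F (permute_word \<sigma> (as @ a # bs)))) =
    alternate (length bs) (Sh_sum (length as) (length bs) (as @ bs) (\<lambda>w. F (w @ [a])))"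
proof -
  let ?r = "length as" and ?s = "length bs"
  have "(\<Sum>\<sigma> | \<sigma> \<in> Sh (Suc ?r) ?s \<and> \<sigma> (Suc ?r) = Suc (?r + ?s).
      int_smult (sign \<sigma>) (F (permute_word \<sigma> (as @ a # bs)))) =
    (\<Sum>\<tau>\<in>Sh ?r ?s. int_smult (sign (\<tau> \<circ> cycle_up ?r ?s))
      (F (permute_word (\<tau> \<circ> cycle_up ?r ?s) (as @ a # bs))))"
    by (rule sum.reindex_bij_betw[OF Sh_last_left, symmetric])
  also have "\<dots> = (\<Sum>\<tau>\<in>Sh ?r ?s. alternate ?s (int_smult (sign \<tau>)
      (F (permute_word \<tau> (as @ bs) @ [a]))))"
  proof (rule sum.cong[OF refl])
    fix \<tau> assume \<tau>: "\<tau> \<in> Sh ?r ?s"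
    then have "sign (\<tau> \<circ> cycle_up ?r ?s) = (- 1) ^ ?s * sign \<tau>"
      using permutes_imp_permutation[OF _ cycle_up_permutes] Sh_permutation[OF \<tau>]
      by (simp add: sign_compose sign_cycle_up)
    moreover have "int_smult ((- 1) ^ ?s * sign \<tau>) x = alternate ?s (int_smult (sign \<tau>) x)" for x :: 'b
      by (cases \<tau> rule: sign_cases) (simp_all add: alternate_def minus_one_power_iff)
    moreover have "permute_word (\<tau> \<circ> cycle_up ?r ?s) (as @ a # bs) = permute_word \<tau> (as @ bs) @ [a]"
      by (rule permute_word_last_left) (use \<tau> in \<open>simp add: Sh_def\<close>)
    ultimately show "int_smult (sign (\<tau> \<circ> cycle_up ?r ?s))
        (F (permute_word (\<tau> \<circ> cycle_up ?r ?s) (as @ a # bs))) =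
      alternate ?s (int_smult (sign \<tau>) (F (permute_word \<tau> (as @ bs) @ [a])))"
      by simp
  qed
  finally show ?thesis by (simp add: Sh_sum_def additive.sum[OF additive_alternate])
qed

lemma Sh_sum_split:
  assumes "0 < r + s"
  shows "Sh_sum r s as F =
    (\<Sum>\<sigma> | \<sigma> \<in> Sh r s \<and> 0 < s \<and> \<sigma> (r + s) = r + s. int_smult (sign \<sigma>) (F (permute_word \<sigma> as))) +
    (\<Sum>\<sigma> | \<sigma> \<in> Sh r s \<and> 0 < r \<and> \<sigma> r = r + s. int_smult (sign \<sigma>) (F (permute_word \<sigma> as)))"
proof -
  have "Sh r s = {\<sigma> \<in> Sh r s. 0 < s \<and> \<sigma> (r + s) = r + s} \<union> {\<sigma> \<in> Sh r s. 0 < r \<and> \<sigma> r = r + s}"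
    using Sh_last_cases[OF _ assms] by blast
  then show ?thesis
    unfolding Sh_sum_def
    by (subst (1) \<open>Sh r s = _\<close>, intro sum.union_disjoint)
      (use Sh_last_cases[OF _ assms] in \<open>auto simp: Sh_finite\<close>)
qed

text \<open>Both sides split according to the word that supplies the last letter. If it is
  \<open>x\<close>, it passes the \<open>Suc (length ys)\<close> letters of the other word, which
  explains the sign in the recursion.\<close>

lemma Sh_sum_eq_shuffle_sum:
  "Sh_sum (length xs) (length ys) (rev xs @ rev ys) F = shuffle_sum xs ys (\<lambda>w. F (rev w))"
proof (induction xs ys "\<lambda>w. F (rev w)" arbitrary: F rule: shuffle_sum.induct)
  case 1
  then show ?case by (simp add: Sh_sum_def Sh_0_0 permute_word_def)
next
  case (2 y ys)
  have "Sh_sum 0 (Suc (length ys)) (rev ys @ [y]) F = Sh_sum 0 (length ys) (rev ys) (\<lambda>w. F (w @ [y]))"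
    using sum_Sh_last_right[where as = "rev ys" and r = 0 and s = "length ys" and F = F and a = y]
    by (subst Sh_sum_split) simp_all
  then show ?case using 2[of "\<lambda>w. F (w @ [y])"] by simp
next
  case (3 x xs)
  have "Sh_sum (Suc (length xs)) 0 (rev xs @ [x]) F = Sh_sum (length xs) 0 (rev xs) (\<lambda>w. F (w @ [x]))"
    using sum_Sh_last_left[where as = "rev xs" and bs = "[]" and F = F and a = x]
    by (subst Sh_sum_split) (simp_all add: alternate_def)
  then show ?case using 3[of "\<lambda>w. F (w @ [x])"] by simp
next
  case (4 x xs y ys)
  have "Sh_sum (Suc (length xs)) (Suc (length ys)) (rev xs @ x # rev ys @ [y]) F =
      Sh_sum (Suc (length xs)) (length ys) (rev xs @ x # rev ys) (\<lambda>w. F (w @ [y])) +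
      alternate (Suc (length ys))
        (Sh_sum (length xs) (Suc (length ys)) (rev xs @ rev ys @ [y]) (\<lambda>w. F (w @ [x])))"
    using sum_Sh_last_right[where as = "rev xs @ x # rev ys" and r = "Suc (length xs)"
        and s = "length ys" and F = F and a = y]
      sum_Sh_last_left[where as = "rev xs" and bs = "rev ys @ [y]" and F = F and a = x]
    by (subst Sh_sum_split) simp_all
  then show ?case
    using 4(1)[of "\<lambda>w. F (w @ [y])"] 4(2)[of "\<lambda>w. F (w @ [x])"] by simp
qed

section \<open>The bar differential is a derivation for the shuffle product\<close>

text \<open>
  Words are still read from right to left. The value of \<open>bar\<close> omits the face that deletes the last
  letter of the word; \<open>bar_full\<close> includes it. On a word of length one, the single face counted by
  \<open>bar\<close> is the empty word.
\<close>

fun add_to_hd :: "'a::ab_group_add \<Rightarrow> 'a list \<Rightarrow> 'a list"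
  where
    "add_to_hd z [] = []"
  | "add_to_hd z (y # w) = (y + z) # w"

primrec bar :: "'a::ab_group_add list \<Rightarrow> ('a list \<Rightarrow> 'b) \<Rightarrow> 'b::ab_group_add"
  where
    "bar [] F = 0"
  | "bar (z # w) F = bar w (\<lambda>u. F (z # u)) + alternate (length w) (F (add_to_hd z w))"

definition bar_full :: "'a::ab_group_add list \<Rightarrow> ('a list \<Rightarrow> 'b) \<Rightarrow> 'b::ab_group_add"
  where "bar_full w F = bar w F + alternate (length w) (F (tl w))"

lemma bar_cong:
  "(\<And>u. Suc (length u) = length w \<Longrightarrow> F u = G u) \<Longrightarrow> bar w F = bar w G"
proof (induction w arbitrary: F G)
  case (Cons z w)
  have "bar w (\<lambda>u. F (z # u)) = bar w (\<lambda>u. G (z # u))"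
    by (rule Cons.IH) (simp add: Cons.prems)
  moreover have "F (add_to_hd z w) = G (add_to_hd z w)"
    by (rule Cons.prems) (cases w; simp)
  ultimately show ?case by simp
qed simp

lemma bar_add: "bar w (\<lambda>u. F u + G u) = bar w F + bar w G"
  by (induction w arbitrary: F G)
    (simp_all add: additive.add[OF additive_alternate] add.assoc add.left_commute)

lemma (in additive) bar: "f (bar w F) = bar w (\<lambda>u. f (F u))"
  by (induction w arbitrary: F) (simp_all add: add zero commute_alternate)

lemma bar_alternate: "bar w (\<lambda>u. alternate k (F u)) = alternate k (bar w F)"
  by (simp add: additive.bar[OF additive_alternate])

text \<open>
  The terms that add a letter of one word to a letter of the other one occur twice, with opposite
  signs; they cancel since addition is commutative.
\<close>

lemma shuffle_sum_add_to_hd: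
  "alternate (Suc (length xs + length ys))
      (shuffle_sum (x # xs) ys (\<lambda>w. F (add_to_hd y w)) +
       alternate (Suc (length ys)) (shuffle_sum xs (y # ys) (\<lambda>w. F (add_to_hd x w)))) =
    alternate (length xs) (shuffle_sum (add_to_hd x xs) (y # ys) F -
      shuffle_sum (add_to_hd x xs) ys (\<lambda>w. F (y # w))) +
    alternate (Suc (length xs + length ys)) (shuffle_sum (x # xs) (add_to_hd y ys) F) -
    alternate (Suc (length xs + length ys))
      (alternate (length ys) (shuffle_sum xs (add_to_hd y ys) (\<lambda>w. F (x # w))))"
  by (cases xs; cases ys) (simp_all add: alternate_def add.commute[of x y])

text \<open>Leibniz rule by induction along the shuffle recursion. Faces that do not touch the last
  letter are covered by the induction hypotheses; those that add the last letter to its predecessor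
  are balanced by \<open>shuffle_sum_add_to_hd\<close>.\<close>

lemma bar_shuffle_sum:
  "shuffle_sum xs ys (\<lambda>w. bar w F) =
    bar xs (\<lambda>u. shuffle_sum u ys F) + alternate (length xs) (bar ys (\<lambda>u. shuffle_sum xs u F))"
proof (induction xs ys F rule: shuffle_sum.induct)
  case (4 x xs y ys F)
  let ?p = "length xs" and ?q = "length ys"
  let ?Fx = "\<lambda>w. F (x # w)" and ?Fy = "\<lambda>w. F (y # w)"
  \<comment> \<open>Facts 1 and 2 split the faces of a shuffle by whether they involve its last
    letter; facts 3 and 4 split shuffles of a face with the other word by their last letter.\<close>
  have 1: "shuffle_sum (x # xs) ys (\<lambda>w. bar (y # w) F) =
      shuffle_sum (x # xs) ys (\<lambda>w. bar w ?Fy) +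
      alternate (Suc (?p + ?q)) (shuffle_sum (x # xs) ys (\<lambda>w. F (add_to_hd y w)))"
    unfolding shuffle_sum_alternate[symmetric] shuffle_sum_add[symmetric]
    by (rule shuffle_sum_cong) simp
  have 2: "shuffle_sum xs (y # ys) (\<lambda>w. bar (x # w) F) =
      shuffle_sum xs (y # ys) (\<lambda>w. bar w ?Fx) +
      alternate (Suc (?p + ?q)) (shuffle_sum xs (y # ys) (\<lambda>w. F (add_to_hd x w)))"
    unfolding shuffle_sum_alternate[symmetric] shuffle_sum_add[symmetric]
    by (rule shuffle_sum_cong) simp
  have 3: "bar xs (\<lambda>u. shuffle_sum (x # u) (y # ys) F) =
      bar xs (\<lambda>u. shuffle_sum (x # u) ys ?Fy) +
      alternate (Suc ?q) (bar xs (\<lambda>u. shuffle_sum u (y # ys) ?Fx))"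
    by (simp add: bar_add bar_alternate)
  have 4: "bar ys (\<lambda>u. shuffle_sum (x # xs) (y # u) F) =
      bar ys (\<lambda>u. shuffle_sum (x # xs) u ?Fy) +
      alternate ?q (bar ys (\<lambda>u. shuffle_sum xs (y # u) ?Fx))"
    \<comment> \<open>The recursion gives the sign exponent \<open>Suc (length u)\<close>, which
      varies with \<open>u\<close>; on the faces of \<open>ys\<close> it equals \<open>?q\<close>,
      and \<open>bar_cong\<close> supplies this length.\<close>
    unfolding bar_alternate[symmetric] bar_add[symmetric]
    by (rule bar_cong) simp
  show ?case
    using shuffle_sum_add_to_hd[of xs ys x F y]
    unfolding shuffle_sum.simps(4)
    unfolding 1 2 "4.IH"
    unfolding bar.simps
    unfolding 3 4 list.size
    by (cases "even ?p"; cases "even ?q") (simp_all add: alternate_def algebra_simps)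
qed (simp_all add: alternate_def[of 0])

text \<open>Deleting the last letter of a shuffle deletes the last letter of one factor, so this
  face obeys the Leibniz rule too. Both factors must have a letter to lose.\<close>

lemma bar_full_shuffle_sum:
  assumes "xs \<noteq> []" "ys \<noteq> []"
  shows "shuffle_sum xs ys (\<lambda>w. bar_full w F) =
    bar_full xs (\<lambda>u. shuffle_sum u ys F) +
    alternate (length xs) (bar_full ys (\<lambda>u. shuffle_sum xs u F))"
proof -
  have "shuffle_sum xs ys (\<lambda>w. bar_full w F) = shuffle_sum xs ys (\<lambda>w. bar w F) +
      alternate (length xs + length ys) (shuffle_sum xs ys (\<lambda>w. F (tl w)))"
    unfolding shuffle_sum_alternate[symmetric] shuffle_sum_add[symmetric]
    by (rule shuffle_sum_cong) (simp add: bar_full_def)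
  also have "alternate (length xs + length ys) (shuffle_sum xs ys (\<lambda>w. F (tl w))) =
      alternate (length xs) (shuffle_sum (tl xs) ys F) +
      alternate (length xs + length ys) (shuffle_sum xs (tl ys) F)"
    using assms by (cases xs; cases ys) (simp_all add: alternate_def)
  finally show ?thesis
    by (simp add: bar_shuffle_sum bar_full_def additive.add[OF additive_alternate]
        alternate_alternate)
qed

lemma bar_mem:
  assumes "additive_closed S" "\<And>u. Suc (length u) = length w \<Longrightarrow> F u \<in> S"
  shows "bar w F \<in> S"
  using assms(2)
proof (induction w arbitrary: F)
  case (Cons z w)
  have "bar w (\<lambda>u. F (z # u)) \<in> S" by (rule Cons.IH) (simp add: Cons.prems)
  moreover have "F (add_to_hd z w) \<in> S" by (rule Cons.prems) (cases w; simp)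
  ultimately show ?case
    using assms(1) additive_closed_alternate[OF assms(1)] by (simp add: additive_closed_def)
qed (use assms(1) in \<open>simp add: additive_closed_def\<close>)

text \<open>The hypothesis on \<open>F\<close> excludes the empty word, as required when
  \<open>F u\<close> is a shuffle of \<open>u\<close> that lies in \<open>ShC\<close> only for
  nonempty \<open>u\<close>. If \<open>w\<close> has one letter, its two deletions both give the
  empty word, with opposite signs.\<close>

lemma bar_full_mem:
  assumes "additive_closed S" "\<And>u. u \<noteq> [] \<Longrightarrow> Suc (length u) = length w \<Longrightarrow> F u \<in> S" "w \<noteq> []"
  shows "bar_full w F \<in> S"
proof (cases "length w = 1")
  case True
  then have "bar_full w F = 0"
    by (cases w) (auto simp: bar_full_def alternate_def)
  then show ?thesis using assms(1) by (simp add: additive_closed_def)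
next
  case False
  have "Suc 0 < length w" using False assms(3) by (cases w) auto
  then have "F u \<in> S" if "Suc (length u) = length w" for u
    using assms(2)[of u] that by fastforce
  then have "bar w F \<in> S" "alternate (length w) (F (tl w)) \<in> S"
    using assms(1,3) by (auto intro!: bar_mem additive_closed_alternate)
  then show ?thesis using assms(1) by (simp add: bar_full_def additive_closed_def)
qed

text \<open>Appending a letter \<open>z\<close> on the right keeps all earlier faces and creates one
  new face, of index \<open>length w\<close>, that adds \<open>z\<close> to the letter before it.
  For empty \<open>w\<close> the new face is instead the deletion with index 0.\<close>

lemma bar_eq_alternating_sum:
  "(\<Sum>k<length w. alternate k (F (if k = 0 then tl (rev w) else add_face k (rev w)))) =
    bar w (\<lambda>u. F (rev u))"
proof (induction w arbitrary: F)
  case (Cons z w)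
  have "(if k = 0 then tl (rev (z # w)) else add_face k (rev (z # w))) =
      (if k = 0 then tl (rev w) else add_face k (rev w)) @ [z]" if "k < length w" for k
    using that by (auto simp: add_face_def nth_append)
  then have "(\<Sum>k<length w. alternate k
        (F (if k = 0 then tl (rev (z # w)) else add_face k (rev (z # w))))) =
      bar w (\<lambda>u. F (rev (z # u)))"
    using Cons.IH[of "\<lambda>u. F (u @ [z])"] by simp
  moreover have "(if length w = 0 then tl (rev (z # w)) else add_face (length w) (rev (z # w))) =
      rev (add_to_hd z w)"
    by (cases w) (auto simp: add_face_def nth_append)
  ultimately show ?case by (simp only: length_Cons sum.lessThan_Suc bar.simps)
qed simp

text \<open>Identifies \<open>bar_full\<close> with the negative of \<open>dv\<close> on basis
  tuples; the untouched prefix \<open>bs\<close> goes into the function.\<close>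

lemma bar_full_eq_alternating_sum:
  assumes "length bs = i" "w \<noteq> []"
  shows "(\<Sum>k\<le>length w. alternate k (F (vface i (length w) k (bs @ rev w)))) =
    bar_full w (\<lambda>u. F (bs @ rev u))"
proof -
  have "vface i (length w) k (bs @ rev w) =
      bs @ (if k = 0 then tl (rev w) else add_face k (rev w))" if "k < length w" for k
    using that assms
    by (auto simp: vface_def add_face_def del_face_def nth_append drop_Suc)
  moreover have "vface i (length w) (length w) (bs @ rev w) = bs @ rev (tl w)"
    using assms by (cases w) (auto simp: vface_def del_face_def)
  ultimately show ?thesis
    using bar_eq_alternating_sum[of "\<lambda>u. F (bs @ u)" w]
    by (simp add: bar_full_def lessThan_Suc_atMost[symmetric])
qed

section \<open>Partial shuffles\<close>

lemma partial_shuffle_eq: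
  assumes "length bs = i" "length xs = r" "length xs + length ys = j"
  shows "partial_shuffle i j r (bs @ rev xs @ rev ys) \<gamma> =
    shuffle_sum xs ys (\<lambda>w. Poly_Mapping.single (bs @ rev w) \<gamma>)"
proof -
  have "map (\<lambda>k. (bs @ rev xs @ rev ys) ! (i + inv_into UNIV \<sigma> k - 1)) [1..<j + 1] =
      permute_word \<sigma> (rev xs @ rev ys)" if "\<sigma> \<in> Sh r (j - r)" for \<sigma>
    unfolding permute_word_def
  proof (rule map_cong)
    fix k assume "k \<in> set [1..<length (rev xs @ rev ys) + 1]"
    moreover have "inv_into UNIV \<sigma> permutes {1..j}"
      using that assms by (auto simp: Sh_def intro: permutes_inv)
    ultimately have "inv_into UNIV \<sigma> k \<in> {1..j}"
      using assms by (subst permutes_in_image) auto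
    then show "(bs @ rev xs @ rev ys) ! (i + inv_into UNIV \<sigma> k - 1) =
        (rev xs @ rev ys) ! (inv_into UNIV \<sigma> k - 1)"
      using assms by (cases "inv_into UNIV \<sigma> k") (auto simp: nth_append[of bs])
  qed (use assms in simp)
  then show ?thesis
    using assms Sh_sum_eq_shuffle_sum[of xs ys "\<lambda>w. Poly_Mapping.single (bs @ w) \<gamma>"]
    by (auto simp: partial_shuffle_def Sh_sum_def intro!: sum.cong)
qed

lemma tuple_split:
  assumes "as \<in> tuples (i + j)" "1 \<le> r" "r \<le> j - 1"
  obtains bs xs ys where "as = bs @ rev xs @ rev ys" "length bs = i" "length xs = r"
    "length xs + length ys = j" "xs \<noteq> []" "ys \<noteq> []"
proof
  show "as = take i as @ rev (rev (take r (drop i as))) @ rev (rev (drop r (drop i as)))"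
    by (metis append_take_drop_id rev_rev_ident)
qed (use assms in \<open>auto simp: tuples_def\<close>)

text \<open>Nonemptiness of both words expresses the bounds on \<open>r\<close> in the
  generators.\<close>

lemma ShC_generators:
  assumes "length bs = i" "length xs + length ys = j" "xs \<noteq> []" "ys \<noteq> []"
  shows "shuffle_sum xs ys (\<lambda>w. Poly_Mapping.single (bs @ rev w) \<gamma>) \<in> ShC i j"
  unfolding ShC_def
proof (rule generate.incl, intro CollectI exI conjI)
  show "shuffle_sum xs ys (\<lambda>w. Poly_Mapping.single (bs @ rev w) \<gamma>) =
      partial_shuffle i j (length xs) (bs @ rev xs @ rev ys) \<gamma>"
    by (rule partial_shuffle_eq[OF assms(1) refl assms(2), symmetric])
  show "1 \<le> length xs" "length xs \<le> j - 1"
    using assms by (cases xs; cases ys; auto)+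
qed (use assms in \<open>simp add: tuples_def\<close>)

lemma shuffle_sum_mem:
  assumes "additive_closed S" "\<And>w. length w = length xs + length ys \<Longrightarrow> F w \<in> S"
  shows "shuffle_sum xs ys F \<in> S"
  using assms(2)
proof (induction xs ys F rule: shuffle_sum.induct)
  case (4 x xs y ys F)
  have "shuffle_sum (x # xs) ys (\<lambda>w. F (y # w)) \<in> S" "shuffle_sum xs (y # ys) (\<lambda>w. F (x # w)) \<in> S"
    using 4 by simp_all
  then show ?case
    using assms(1) additive_closed_alternate[OF assms(1)] by (simp add: additive_closed_def)
qed auto

lemma ShC_generators_closed:
  "{partial_shuffle i j r as \<gamma> | r as \<gamma>. 1 \<le> r \<and> r \<le> j - 1 \<and> as \<in> tuples (i + j)} \<subseteq>
    carrier (chain_group (i + j))"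
proof clarify
  fix r and as :: "'a list" and \<gamma> :: 'b
  assume "1 \<le> r" "r \<le> j - 1" "as \<in> tuples (i + j)"
  then obtain bs xs ys where "as = bs @ rev xs @ rev ys" "length bs = i" "length xs = r"
    "length xs + length ys = j" by (metis tuple_split)
  then show "partial_shuffle i j r as \<gamma> \<in> carrier (chain_group (i + j))"
    by (simp only: partial_shuffle_eq)
      (rule shuffle_sum_mem[OF additive_closed_chains]; simp add: tuples_def)
qed

lemma subgroup_ShC: "subgroup (ShC i j) (chain_group (i + j))"
  unfolding ShC_def by (rule subgroup_generate_chains[OF ShC_generators_closed])

lemma additive_image_ShC:
  assumes "additive f" "additive_closed T" "c \<in> ShC i j"
    and "\<And>bs xs ys \<gamma>. length bs = i \<Longrightarrow> length xs + length ys = j \<Longrightarrow> xs \<noteq> [] \<Longrightarrow> ys \<noteq> [] \<Longrightarrow>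
      shuffle_sum xs ys (\<lambda>w. f (Poly_Mapping.single (bs @ rev w) \<gamma>)) \<in> T"
  shows "f c \<in> T"
proof (rule additive_image_generate[OF assms(1) ShC_generators_closed assms(2) _
      assms(3)[unfolded ShC_def]])
  fix x :: "'a list \<Rightarrow>\<^sub>0 'b"
  assume "x \<in> {partial_shuffle i j r as \<gamma> | r as \<gamma>. 1 \<le> r \<and> r \<le> j - 1 \<and> as \<in> tuples (i + j)}"
  then obtain r as \<gamma> where x: "x = partial_shuffle i j r as \<gamma>" "1 \<le> r" "r \<le> j - 1"
    "as \<in> tuples (i + j)" by blast
  obtain bs xs ys where "as = bs @ rev xs @ rev ys" "length bs = i" "length xs = r"
    "length xs + length ys = j" "xs \<noteq> []" "ys \<noteq> []"
    using tuple_split[OF x(4,2,3)] by metis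
  with x assms(4) show "f x \<in> T"
    by (simp add: partial_shuffle_eq additive.shuffle_sum[OF assms(1)])
qed

text \<open>Neither \<open>bs'\<close> nor \<open>g\<close> depends on \<open>w\<close>: the action
  face translates every letter by the first entry of \<open>bs\<close>, and the other faces change
  only \<open>bs\<close>. So all words of one shuffle are transformed by the same letterwise
  map.\<close>

lemma hface_append:
  assumes "1 \<le> i" "length bs = i" "k \<le> i"
  obtains bs' g where "length bs' = i - 1" "\<And>w. w \<noteq> [] \<Longrightarrow> hface dot i k (bs @ w) = bs' @ map g w"
proof (cases "k = 0")
  case True
  show ?thesis
    by (rule that[of "map (dot (hd bs)) (tl bs)" "dot (hd bs)"])
      (use assms True in \<open>cases bs; auto simp: hface_def act_face_def\<close>)+
next
  case False
  show ?thesis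
    by (rule that[of "hface dot i k bs" id])
      (use assms False in \<open>auto simp: hface_def add_face_def del_face_def nth_append\<close>)
qed

lemma dh_ShC:
  assumes "1 \<le> i" "1 \<le> j" "c \<in> ShC i j"
  shows "dh dot i j c \<in> ShC (i - 1) j"
proof (rule additive_image_ShC[OF additive_dh additive_closed_subgroup[OF subgroup_ShC] assms(3)])
  fix bs xs ys :: "'a list" and \<gamma> :: 'b
  assume len: "length bs = i" "length xs + length ys = j" "xs \<noteq> []" "ys \<noteq> []"
  have "shuffle_sum xs ys (\<lambda>w. Poly_Mapping.single (hface dot i k (bs @ rev w)) \<gamma>) \<in> ShC (i - 1) j"
    if k: "k \<le> i" for k
  proof -
    obtain bs' g where bs': "length bs' = i - 1"
        "\<And>w. w \<noteq> [] \<Longrightarrow> hface dot i k (bs @ w) = bs' @ map g w"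
      using hface_append[OF assms(1) len(1) k] by metis
    have "shuffle_sum xs ys (\<lambda>w. Poly_Mapping.single (hface dot i k (bs @ rev w)) \<gamma>) =
        shuffle_sum xs ys (\<lambda>w. Poly_Mapping.single (bs' @ rev (map g w)) \<gamma>)"
    proof (rule shuffle_sum_cong)
      fix w :: "'a list" assume "length w = length xs + length ys"
      with len have "rev w \<noteq> []" by auto
      then show "Poly_Mapping.single (hface dot i k (bs @ rev w)) \<gamma> =
          Poly_Mapping.single (bs' @ rev (map g w)) \<gamma>"
        using bs'(2)[of "rev w"] by (simp add: rev_map)
    qed
    also have "\<dots> = shuffle_sum (map g xs) (map g ys) (\<lambda>w. Poly_Mapping.single (bs' @ rev w) \<gamma>)"
      by (simp add: shuffle_sum_map)
    also have "\<dots> \<in> ShC (i - 1) j"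
      by (rule ShC_generators) (use len bs' in auto)
    finally show ?thesis .
  qed
  moreover have "shuffle_sum xs ys (\<lambda>w. dh dot i j (Poly_Mapping.single (bs @ rev w) \<gamma>)) =
      (\<Sum>k\<le>i. alternate k
        (shuffle_sum xs ys (\<lambda>w. Poly_Mapping.single (hface dot i k (bs @ rev w)) \<gamma>)))"
  proof -
    have "shuffle_sum xs ys (\<lambda>w. \<Sum>k\<in>K. F k w) = (\<Sum>k\<in>K. shuffle_sum xs ys (F k))"
      if "finite K" for K and F :: "nat \<Rightarrow> 'a list \<Rightarrow> 'a list \<Rightarrow>\<^sub>0 'b"
      using that
    proof (induction K)
      case empty
      have "shuffle_sum xs ys (\<lambda>w. 0) = (0 :: 'a list \<Rightarrow>\<^sub>0 'b)"
        using shuffle_sum_add[of xs ys "\<lambda>w. 0 :: 'a list \<Rightarrow>\<^sub>0 'b" "\<lambda>w. 0"] by simp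
      then show ?case by simp
    qed (simp add: shuffle_sum_add)
    then show ?thesis by (simp add: dh_single[OF assms(1)] shuffle_sum_alternate)
  qed
  ultimately show "shuffle_sum xs ys (\<lambda>w. dh dot i j (Poly_Mapping.single (bs @ rev w) \<gamma>)) \<in>
      ShC (i - 1) j"
    by (auto intro!: additive_closed_sum additive_closed_alternate
        additive_closed_subgroup[OF subgroup_ShC])
qed

lemma dv_ShC:
  assumes "2 \<le> j" "c \<in> ShC i j"
  shows "dv i j c \<in> ShC i (j - 1)"
proof (rule additive_image_ShC[OF additive_dv additive_closed_subgroup[OF subgroup_ShC] assms(2)])
  fix bs xs ys :: "'a list" and \<gamma> :: 'b
  assume len: "length bs = i" "length xs + length ys = j" "xs \<noteq> []" "ys \<noteq> []"
  let ?F = "\<lambda>u. Poly_Mapping.single (bs @ rev u) \<gamma>" and ?S = "ShC i (j - 1) :: ('a list \<Rightarrow>\<^sub>0 'b) set"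
  have S: "additive_closed ?S" by (rule additive_closed_subgroup[OF subgroup_ShC])
  have "shuffle_sum xs ys (\<lambda>w. - dv i j (Poly_Mapping.single (bs @ rev w) \<gamma>)) =
      shuffle_sum xs ys (\<lambda>w. bar_full w ?F)"
  proof (rule shuffle_sum_cong)
    fix w :: "'a list" assume "length w = length xs + length ys"
    moreover from this len have "w \<noteq> []" by auto
    ultimately show "- dv i j (Poly_Mapping.single (bs @ rev w) \<gamma>) = bar_full w ?F"
      using bar_full_eq_alternating_sum[of bs i w "\<lambda>u. Poly_Mapping.single u \<gamma>"] len assms(1)
      by (auto simp: dv_single)
  qed
  also have "\<dots> = bar_full xs (\<lambda>u. shuffle_sum u ys ?F) +
      alternate (length xs) (bar_full ys (\<lambda>u. shuffle_sum xs u ?F))"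
    by (rule bar_full_shuffle_sum[OF len(3,4)])
  also have "\<dots> \<in> ?S"
  proof -
    \<comment> \<open>Every term left by the Leibniz rule is a shuffle with one factor shortened by
      a letter; \<open>bar_full_mem\<close> ensures that only nonempty factors need to be
      considered.\<close>
    have "bar_full xs (\<lambda>u. shuffle_sum u ys ?F) \<in> ?S"
      by (rule bar_full_mem[OF S _ len(3)], rule ShC_generators) (use len in auto)
    moreover have "bar_full ys (\<lambda>u. shuffle_sum xs u ?F) \<in> ?S"
      by (rule bar_full_mem[OF S _ len(4)], rule ShC_generators) (use len in auto)
    ultimately show ?thesis
      using S additive_closed_alternate[OF S] by (simp add: additive_closed_def)
  qed
  finally have "- shuffle_sum xs ys (\<lambda>w. - dv i j (Poly_Mapping.single (bs @ rev w) \<gamma>)) \<in> ?S"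
    by (rule additive_closed_uminus[OF S])
  then show "shuffle_sum xs ys (\<lambda>w. dv i j (Poly_Mapping.single (bs @ rev w) \<gamma>)) \<in> ?S"
    \<comment> \<open>Negation is \<open>alternate 1\<close>, which can be moved out of the shuffle
      sum.\<close>
    using shuffle_sum_alternate[of xs ys 1 "\<lambda>w. dv i j (Poly_Mapping.single (bs @ rev w) \<gamma>)"]
    by (simp add: alternate_def)
qed

section \<open>Restrictions and quotients of chain bicomplexes\<close>

lemma comm_group_subgroup:
  assumes "comm_group G" "subgroup H G"
  shows "comm_group (G\<lparr>carrier := H\<rparr>)"
proof -
  interpret G: comm_group G by fact
  show ?thesis
    by (rule group.group_comm_groupI[OF G.subgroup_imp_group[OF assms(2)]])
      (auto simp: G.m_comm subgroup.mem_carrier[OF assms(2)])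
qed

lemma hom_restrict:
  assumes "f \<in> hom G G'" "subgroup H G" "\<And>x. x \<in> H \<Longrightarrow> f x \<in> H'"
  shows "f \<in> hom (G\<lparr>carrier := H\<rparr>) (G'\<lparr>carrier := H'\<rparr>)"
  using assms subgroup.mem_carrier[OF assms(2)] by (auto simp: hom_def)

lemma (in chain_bicomplex) restricts_to:
  assumes "\<And>i j. 1 \<le> j \<Longrightarrow> subgroup (H i j) (C i j)"
    and "\<And>i j x. 1 \<le> i \<Longrightarrow> 1 \<le> j \<Longrightarrow> x \<in> H i j \<Longrightarrow> dh i j x \<in> H (i - 1) j"
    and "\<And>i j x. 2 \<le> j \<Longrightarrow> x \<in> H i j \<Longrightarrow> dv i j x \<in> H i (j - 1)"
  shows "chain_restricts_to C dh dv H"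
proof -
  have mem: "x \<in> carrier (C i j)" if "1 \<le> j" "x \<in> H i j" for i j x
    using that by (rule subgroup.mem_carrier[OF assms(1)])
  have "chain_bicomplex (\<lambda>i j. (C i j)\<lparr>carrier := H i j\<rparr>) dh dv"
  proof (rule chain_bicomplex.intro)
    show "comm_group ((C i j)\<lparr>carrier := H i j\<rparr>)" if "1 \<le> j" for i j
      using that by (intro comm_group_subgroup comm_group assms)
    show "dh i j \<in> hom ((C i j)\<lparr>carrier := H i j\<rparr>) ((C (i - 1) j)\<lparr>carrier := H (i - 1) j\<rparr>)"
      if "1 \<le> i" "1 \<le> j" for i j
      using that by (intro hom_restrict dh_hom assms)
    show "dv i j \<in> hom ((C i j)\<lparr>carrier := H i j\<rparr>) ((C i (j - 1))\<lparr>carrier := H i (j - 1)\<rparr>)"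
      if "2 \<le> j" for i j
      using that by (intro hom_restrict dv_hom assms) auto
  qed (simp_all add: mem dh_dh dv_dv dh_dv del: One_nat_def)
  then show ?thesis using assms(1) by (simp add: chain_restricts_to_def)
qed

lemma (in cochain_bicomplex) restricts_to:
  assumes "\<And>i j. 1 \<le> j \<Longrightarrow> subgroup (H i j) (C i j)"
    and "\<And>i j x. 1 \<le> j \<Longrightarrow> x \<in> H i j \<Longrightarrow> dh i j x \<in> H (i + 1) j"
    and "\<And>i j x. 1 \<le> j \<Longrightarrow> x \<in> H i j \<Longrightarrow> dv i j x \<in> H i (j + 1)"
  shows "cochain_restricts_to C dh dv H"
proof -
  have mem: "x \<in> carrier (C i j)" if "1 \<le> j" "x \<in> H i j" for i j x
    using that by (rule subgroup.mem_carrier[OF assms(1)])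
  have "cochain_bicomplex (\<lambda>i j. (C i j)\<lparr>carrier := H i j\<rparr>) dh dv"
  proof (rule cochain_bicomplex.intro)
    show "comm_group ((C i j)\<lparr>carrier := H i j\<rparr>)" if "1 \<le> j" for i j
      using that by (intro comm_group_subgroup comm_group assms)
    show "dh i j \<in> hom ((C i j)\<lparr>carrier := H i j\<rparr>) ((C (i + 1) j)\<lparr>carrier := H (i + 1) j\<rparr>)"
      if "1 \<le> j" for i j
      using that by (intro hom_restrict dh_hom assms)
    show "dv i j \<in> hom ((C i j)\<lparr>carrier := H i j\<rparr>) ((C i (j + 1))\<lparr>carrier := H i (j + 1)\<rparr>)"
      if "1 \<le> j" for i j
      using that by (intro hom_restrict dv_hom assms)
  qed (use dh_dh dv_dv dh_dv mem in auto)
  then show ?thesis using assms(1) by (simp add: cochain_restricts_to_def)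
qed

text \<open>Well-definedness on cosets: all representatives have the same image coset, so the set to
  which \<open>the_elem\<close> is applied is a singleton.\<close>

lemma induced_map_rcoset:
  assumes "group G" "group G'" "f \<in> hom G G'" "subgroup H G" "subgroup H' G'"
    and "\<And>x. x \<in> H \<Longrightarrow> f x \<in> H'" "x \<in> carrier G"
  shows "induced_map G' H' f (H #>\<^bsub>G\<^esub> x) = H' #>\<^bsub>G'\<^esub> f x"
proof -
  interpret G: group G by fact
  interpret G': group G' by fact
  have "H' #>\<^bsub>G'\<^esub> f (h \<otimes>\<^bsub>G\<^esub> x) = H' #>\<^bsub>G'\<^esub> f x" if "h \<in> H" for h
  proof -
    have h: "h \<in> carrier G" "f h \<in> H'" "f h \<in> carrier G'" "f x \<in> carrier G'"
      using that assms subgroup.mem_carrier[OF assms(4)] by (auto simp: hom_def)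
    have "H' #>\<^bsub>G'\<^esub> f (h \<otimes>\<^bsub>G\<^esub> x) = (H' #>\<^bsub>G'\<^esub> f h) #>\<^bsub>G'\<^esub> f x"
      using h assms(7) subgroup.subset[OF assms(5)]
      by (simp add: G'.coset_mult_assoc hom_mult[OF assms(3)])
    then show ?thesis using h assms(5) by (simp add: G'.coset_join2)
  qed
  moreover have "\<one>\<^bsub>G\<^esub> \<in> H" by (rule subgroup.one_closed[OF assms(4)])
  ultimately have "(\<lambda>y. H' #>\<^bsub>G'\<^esub> f y) ` (H #>\<^bsub>G\<^esub> x) = {H' #>\<^bsub>G'\<^esub> f x}"
    by (auto simp: r_coset_def[of G] image_iff)
  then show ?thesis by (simp add: induced_map_def)
qed

lemma induced_map_hom:
  assumes "comm_group G" "comm_group G'" "f \<in> hom G G'" "subgroup H G" "subgroup H' G'"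
    and "\<And>x. x \<in> H \<Longrightarrow> f x \<in> H'"
  shows "induced_map G' H' f \<in> hom (G Mod H) (G' Mod H')"
proof -
  interpret G: comm_group G by fact
  interpret G': comm_group G' by fact
  interpret H: normal H G using assms(4) by (simp add: G.normal_iff_subgroup)
  interpret H': normal H' G' using assms(5) by (simp add: G'.normal_iff_subgroup)
  note ind = induced_map_rcoset[OF G.group_axioms G'.group_axioms assms(3-6)]
  have "f x \<in> carrier G'" if "x \<in> carrier G" for x using assms(3) that by (auto simp: hom_def)
  then show ?thesis
    by (intro homI) (auto simp: carrier_FactGroup ind H.rcos_sum H'.rcos_sum hom_mult[OF assms(3)])
qed

lemma (in chain_bicomplex) induces_quotient:
  assumes "\<And>i j. 1 \<le> j \<Longrightarrow> subgroup (H i j) (C i j)"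
    and "\<And>i j x. 1 \<le> i \<Longrightarrow> 1 \<le> j \<Longrightarrow> x \<in> H i j \<Longrightarrow> dh i j x \<in> H (i - 1) j"
    and "\<And>i j x. 2 \<le> j \<Longrightarrow> x \<in> H i j \<Longrightarrow> dv i j x \<in> H i (j - 1)"
  shows "induces_quotient_chain_bicomplex C dh dv H"
proof -
  define dh' where "dh' i j = induced_map (C (i - 1) j) (H (i - 1) j) (dh i j)" for i j
  define dv' where "dv' i j = induced_map (C i (j - 1)) (H i (j - 1)) (dv i j)" for i j
  have grp: "group (C i j)" if "1 \<le> j" for i j
    using comm_group[OF that] by (simp add: comm_group_def)
  have dh'_coset: "dh' i j (H i j #>\<^bsub>C i j\<^esub> x) = H (i - 1) j #>\<^bsub>C (i - 1) j\<^esub> dh i j x"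
    if "1 \<le> i" "1 \<le> j" "x \<in> carrier (C i j)" for i j x
    unfolding dh'_def using that assms by (intro induced_map_rcoset grp dh_hom) auto
  have dv'_coset: "dv' i j (H i j #>\<^bsub>C i j\<^esub> x) = H i (j - 1) #>\<^bsub>C i (j - 1)\<^esub> dv i j x"
    if "2 \<le> j" "x \<in> carrier (C i j)" for i j x
    unfolding dv'_def using that assms by (intro induced_map_rcoset grp dv_hom) auto
  have dh_carrier: "dh i j x \<in> carrier (C (i - 1) j)"
    if "1 \<le> i" "1 \<le> j" "x \<in> carrier (C i j)" for i j x
    using dh_hom[OF that(1,2)] that(3) by (auto simp: hom_def)
  have dv_carrier: "dv i j x \<in> carrier (C i (j - 1))" if "2 \<le> j" "x \<in> carrier (C i j)" for i j x
    using dv_hom[OF that(1)] that(2) by (auto simp: hom_def)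
  have one: "H i j #>\<^bsub>C i j\<^esub> \<one>\<^bsub>C i j\<^esub> = H i j" if "1 \<le> j" for i j
    using group.coset_mult_one[OF grp subgroup.subset[OF assms(1)]] that by blast
  have "chain_bicomplex (\<lambda>i j. C i j Mod H i j) dh' dv'"
  proof (rule chain_bicomplex.intro)
    fix i j :: nat assume "1 \<le> j"
    then show "comm_group (C i j Mod H i j)"
      by (intro comm_group.abelian_FactGroup comm_group assms)
  next
    fix i j :: nat assume "1 \<le> i" "1 \<le> j"
    then show "dh' i j \<in> hom (C i j Mod H i j) (C (i - 1) j Mod H (i - 1) j)"
      unfolding dh'_def by (intro induced_map_hom comm_group dh_hom assms) auto
  next
    fix i j :: nat assume "2 \<le> j"
    then show "dv' i j \<in> hom (C i j Mod H i j) (C i (j - 1) Mod H i (j - 1))"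
      unfolding dv'_def by (intro induced_map_hom comm_group dv_hom assms) auto
  next
    fix i j X assume ij: "2 \<le> i" "1 \<le> j" and "X \<in> carrier (C i j Mod H i j)"
    then obtain x where x: "x \<in> carrier (C i j)" "X = H i j #>\<^bsub>C i j\<^esub> x"
      by (auto simp: carrier_FactGroup)
    have "dh' (i - 1) j (dh' i j X) = H (i - 1 - 1) j #>\<^bsub>C (i - 1 - 1) j\<^esub> dh (i - 1) j (dh i j x)"
      using ij x dh_carrier[of i j x] by (simp only: dh'_coset x(2))
    also have "i - 1 - 1 = i - 2" by simp
    finally show "dh' (i - 1) j (dh' i j X) = \<one>\<^bsub>C (i - 2) j Mod H (i - 2) j\<^esub>"
      using ij x dh_dh one by simp
  next
    fix i j X assume ij: "3 \<le> j" and "X \<in> carrier (C i j Mod H i j)"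
    then obtain x where x: "x \<in> carrier (C i j)" "X = H i j #>\<^bsub>C i j\<^esub> x"
      by (auto simp: carrier_FactGroup)
    have "dv' i (j - 1) (dv' i j X) = H i (j - 1 - 1) #>\<^bsub>C i (j - 1 - 1)\<^esub> dv i (j - 1) (dv i j x)"
      using ij x dv_carrier[of j x i] by (simp only: dv'_coset x(2))
    also have "j - 1 - 1 = j - 2" by simp
    finally show "dv' i (j - 1) (dv' i j X) = \<one>\<^bsub>C i (j - 2) Mod H i (j - 2)\<^esub>"
      using ij x dv_dv one by simp
  next
    fix i j X assume ij: "1 \<le> i" "2 \<le> j" and "X \<in> carrier (C i j Mod H i j)"
    then obtain x where x: "x \<in> carrier (C i j)" "X = H i j #>\<^bsub>C i j\<^esub> x"
      by (auto simp: carrier_FactGroup)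
    have "dh' i (j - 1) (dv' i j X) = H (i - 1) (j - 1) #>\<^bsub>C (i - 1) (j - 1)\<^esub> dh i (j - 1) (dv i j x)"
      using ij x dv_carrier[of j x i] by (simp add: dv'_coset dh'_coset)
    also have "\<dots> = dv' (i - 1) j (dh' i j X)"
      using ij x dh_carrier[of i j x] by (simp only: dv'_coset dh'_coset dh_dv[OF ij x(1)])
    finally show "dh' i (j - 1) (dv' i j X) = dv' (i - 1) j (dh' i j X)" .
  qed
  moreover have "H i j \<lhd> C i j" if "1 \<le> j" for i j
    using that assms(1) comm_group by (simp add: comm_group.normal_iff_subgroup)
  ultimately show ?thesis
    unfolding induces_quotient_chain_bicomplex_def Let_def
    using dh'_coset dv'_coset by (auto simp: dh'_def[abs_def] dv'_def[abs_def])
qed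

lemma chain_bicomplex_chain_group:
  assumes "linear_cycle_set dot"
  shows "chain_bicomplex (\<lambda>i j. chain_group (i + j)) (dh dot) dv"
proof (rule chain_bicomplex.intro)
  show "dh dot i j \<in> hom (chain_group (i + j)) (chain_group (i - 1 + j))" if "1 \<le> i" "1 \<le> j" for i j
    using dh_closed[OF that]
    by (auto simp: hom_def additive.add[OF additive_dh] simp del: carrier_chain_group)
  show "dv i j \<in> hom (chain_group (i + j)) (chain_group (i + (j - 1)))" if "2 \<le> j" for i j
    using dv_closed[OF that]
    by (auto simp: hom_def additive.add[OF additive_dv] simp del: carrier_chain_group)
qed (simp_all add: comm_group_chain_group dh_dh_eq_0[OF assms] dv_dv_eq_0 dh_dv_commute[OF assms]
    del: carrier_chain_group One_nat_def)

section \<open>Cochains\<close>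

lemma carrier_cochain_group [simp]: "carrier (cochain_group n) = tuples n \<rightarrow>\<^sub>E UNIV"
  and mult_cochain_group [simp]: "f \<otimes>\<^bsub>cochain_group n\<^esub> g = (\<lambda>as\<in>tuples n. f as + g as)"
  and one_cochain_group [simp]: "\<one>\<^bsub>cochain_group n\<^esub> = (\<lambda>as\<in>tuples n. 0)"
  by (simp_all add: cochain_group_def)

lemma comm_group_cochain_group:
  "comm_group (cochain_group n :: ('a list \<Rightarrow> 'g::ab_group_add) monoid)"
proof (rule comm_groupI)
  fix f :: "'a list \<Rightarrow> 'g"
  assume "f \<in> carrier (cochain_group n)"
  then show "\<exists>g\<in>carrier (cochain_group n). g \<otimes>\<^bsub>cochain_group n\<^esub> f = \<one>\<^bsub>cochain_group n\<^esub>"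
    by (intro bexI[of _ "\<lambda>as\<in>tuples n. - f as"]) auto
qed (auto simp: algebra_simps PiE_iff intro!: restrict_ext extensionalityI[of _ "tuples n"])

section \<open>Pairing of cochains with integral chains\<close>

lemma linearize_cong:
  "(\<And>as. as \<in> tuples n \<Longrightarrow> f as = g as) \<Longrightarrow> c \<in> carrier (chain_group n) \<Longrightarrow>
    linearize f c = linearize g c"
  unfolding linearize_def by (rule sum.cong) auto

lemma linearize_mult:
  assumes "c \<in> carrier (chain_group n)"
  shows "linearize (f \<otimes>\<^bsub>cochain_group n\<^esub> g) c = linearize f c + linearize g c"
proof -
  have "linearize (f \<otimes>\<^bsub>cochain_group n\<^esub> g) c = linearize (\<lambda>as. f as + g as) c"
    by (rule linearize_cong[OF _ assms]) simp
  then show ?thesis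
    by (simp add: linearize_def additive.add[OF additive_int_smult] sum.distrib)
qed

lemma linearize_one:
  assumes "c \<in> carrier (chain_group n)"
  shows "linearize \<one>\<^bsub>cochain_group n\<^esub> c = 0"
proof -
  have "linearize \<one>\<^bsub>cochain_group n\<^esub> c = linearize (\<lambda>_. 0) c"
    by (rule linearize_cong[OF _ assms]) simp
  then show ?thesis by (simp add: linearize_def)
qed

lemma int_smult_int_1: "int_smult n (1 :: int) = n"
  by (simp add: int_smult_def)

text \<open>The cochain on the left is known only through basis tuples with coefficient 1.
  Additivity extends this to all chains and shows that it is the transpose of
  \<open>D\<close>.\<close>

lemma linearize_dual:
  fixes D :: "('a list \<Rightarrow>\<^sub>0 int) \<Rightarrow> ('a list \<Rightarrow>\<^sub>0 int)"
  assumes "additive D" "c \<in> carrier (chain_group n)"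
  shows "linearize (\<lambda>as\<in>tuples n. linearize f (D (Poly_Mapping.single as 1))) c = linearize f (D c)"
proof (rule additive_eq_on_chains[OF additive_linearize _ _ assms(2)])
  show add: "additive (\<lambda>c. linearize f (D c))"
    by (rule additive_compose[OF additive_linearize assms(1)])
  fix as :: "'a list" and m :: int
  assume as: "as \<in> tuples n"
  have "additive (\<lambda>m :: int. Poly_Mapping.single as m)"
    by (simp add: additive_def single_add)
  from additive.commute_int_smult[OF this, of m 1]
  have single: "Poly_Mapping.single as m = int_smult m (Poly_Mapping.single as (1 :: int))"
    by (simp add: int_smult_int_1)
  have "linearize (\<lambda>as\<in>tuples n. linearize f (D (Poly_Mapping.single as 1)))
      (Poly_Mapping.single as m) = int_smult m (linearize f (D (Poly_Mapping.single as 1)))"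
    using as by simp
  also have "\<dots> = linearize f (D (Poly_Mapping.single as m))"
    unfolding single by (rule additive.commute_int_smult[OF add, symmetric])
  finally show "linearize (\<lambda>as\<in>tuples n. linearize f (D (Poly_Mapping.single as 1)))
      (Poly_Mapping.single as m) = linearize f (D (Poly_Mapping.single as m))" .
qed

lemma linearize_codh:
  "c \<in> carrier (chain_group (i + 1 + j)) \<Longrightarrow>
    linearize (codh dot i j f) c = linearize f (dh dot (i + 1) j c)"
  unfolding codh_def by (rule linearize_dual[OF additive_dh])

lemma linearize_codv:
  "c \<in> carrier (chain_group (i + (j + 1))) \<Longrightarrow>
    linearize (codv i j f) c = linearize f (dv i (j + 1) c)"
  unfolding codv_def by (rule linearize_dual[OF additive_dv])

lemma cochain_bicomplex_cochain_group:
  assumes "linear_cycle_set (dot :: 'a::ab_group_add \<Rightarrow> 'a \<Rightarrow> 'a)"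
  shows "cochain_bicomplex (\<lambda>i j. cochain_group (i + j) :: ('a list \<Rightarrow> 'g::ab_group_add) monoid)
    (codh dot) codv"
proof (rule cochain_bicomplex.intro)
  fix i j :: nat and f :: "'a list \<Rightarrow> 'g"
  assume j: "1 \<le> j"
  define c :: "'a list \<Rightarrow> 'a list \<Rightarrow>\<^sub>0 int" where "c as = Poly_Mapping.single as 1" for as
  have c: "c as \<in> carrier (chain_group n)" if "as \<in> tuples n" for as n
    using that by (simp add: c_def)
  have codh_c: "codh dot i j f = (\<lambda>as\<in>tuples (i + 1 + j). linearize f (dh dot (i + 1) j (c as)))"
    for i j and f :: "'a list \<Rightarrow> 'g"
    by (simp add: codh_def c_def)
  have codv_c: "codv i j f = (\<lambda>as\<in>tuples (i + (j + 1)). linearize f (dv i (j + 1) (c as)))"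
    for i j and f :: "'a list \<Rightarrow> 'g"
    by (simp add: codv_def c_def)
  have zero: "linearize f 0 = 0" by (rule additive.zero[OF additive_linearize])
  show "comm_group (cochain_group (i + j))" by (rule comm_group_cochain_group)
  show "codh dot i j \<in> hom (cochain_group (i + j) :: ('a list \<Rightarrow> 'g) monoid) (cochain_group (i + 1 + j))"
  proof (rule homI)
    fix f g :: "'a list \<Rightarrow> 'g"
    define h where "h = f \<otimes>\<^bsub>cochain_group (i + j)\<^esub> g"
    have "linearize h (dh dot (i + 1) j (c as)) =
        linearize f (dh dot (i + 1) j (c as)) + linearize g (dh dot (i + 1) j (c as))"
      if "as \<in> tuples (i + 1 + j)" for as
      unfolding h_def using dh_closed[of "i + 1" j, OF _ j c[OF that]] by (intro linearize_mult) simp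
    then show "codh dot i j h = codh dot i j f \<otimes>\<^bsub>cochain_group (i + 1 + j)\<^esub> codh dot i j g"
      by (auto simp: codh_c intro!: restrict_ext)
  qed (simp add: codh_def)
  show "codv i j \<in> hom (cochain_group (i + j) :: ('a list \<Rightarrow> 'g) monoid) (cochain_group (i + (j + 1)))"
  proof (rule homI)
    fix f g :: "'a list \<Rightarrow> 'g"
    define h where "h = f \<otimes>\<^bsub>cochain_group (i + j)\<^esub> g"
    have "linearize h (dv i (j + 1) (c as)) =
        linearize f (dv i (j + 1) (c as)) + linearize g (dv i (j + 1) (c as))"
      if "as \<in> tuples (i + (j + 1))" for as
      unfolding h_def using j dv_closed[of "j + 1", OF _ c[OF that]] by (intro linearize_mult) simp
    then show "codv i j h = codv i j f \<otimes>\<^bsub>cochain_group (i + (j + 1))\<^esub> codv i j g"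
      by (auto simp: codv_c intro!: restrict_ext)
  qed (simp add: codv_def)
  \<comment> \<open>Evaluation at a basis tuple moves both codifferentials to the chain side, where
    the composite of the differentials is 0. The other two identities are transposed
    likewise.\<close>
  have "linearize (codh dot i j f) (dh dot (i + 1 + 1) j (c as)) = 0"
    if "as \<in> tuples (i + 1 + 1 + j)" for as
  proof -
    have "dh dot (i + 1 + 1) j (c as) \<in> carrier (chain_group (i + 1 + j))"
      using dh_closed[OF _ j c[OF that]] by simp
    then show ?thesis
      using dh_dh_eq_0[OF assms _ j c[OF that]] zero by (simp only: linearize_codh) simp
  qed
  then show "codh dot (i + 1) j (codh dot i j f) = \<one>\<^bsub>cochain_group (i + 2 + j)\<^esub>"
    unfolding codh_c[of "i + 1"] one_cochain_group by (simp cong: restrict_cong)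
  have "linearize (codv i j f) (dv i (j + 1 + 1) (c as)) = 0"
    if "as \<in> tuples (i + (j + 1 + 1))" for as
  proof -
    have "dv i (j + 1 + 1) (c as) \<in> carrier (chain_group (i + (j + 1)))"
      using dv_closed[OF _ c[OF that]] j by simp
    then show ?thesis
      using dv_dv_eq_0[OF _ c[OF that]] zero j by (simp only: linearize_codv) simp
  qed
  then show "codv i (j + 1) (codv i j f) = \<one>\<^bsub>cochain_group (i + (j + 2))\<^esub>"
    unfolding codv_c[of i "j + 1"] one_cochain_group by (simp cong: restrict_cong)
  have "linearize (codv i j f) (dh dot (i + 1) (j + 1) (c as)) =
      linearize (codh dot i j f) (dv (i + 1) (j + 1) (c as))"
    if as: "as \<in> tuples (i + 1 + (j + 1))" for as
  proof -
    have "dh dot (i + 1) (j + 1) (c as) \<in> carrier (chain_group (i + (j + 1)))"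
      using dh_closed[OF _ _ c[OF as]] j by simp
    moreover have "dv (i + 1) (j + 1) (c as) \<in> carrier (chain_group (i + 1 + j))"
      using dv_closed[OF _ c[OF as]] j by simp
    ultimately show ?thesis
      using dh_dv_commute[OF assms _ _ c[OF as]] j by (simp only: linearize_codh linearize_codv) simp
  qed
  then show "codh dot i (j + 1) (codv i j f) = codv (i + 1) j (codh dot i j f)"
    unfolding codh_c[of i "j + 1"] codv_c[of "i + 1"] by (simp cong: restrict_cong)
qed

text \<open>Turns restriction on chains into restriction on cochains: if a differential maps
  \<open>N\<close> into \<open>M\<close>, its transpose maps cochains vanishing on \<open>M\<close>
  to cochains vanishing on \<open>N\<close>.\<close>

definition annihilator :: "nat \<Rightarrow> ('a list \<Rightarrow>\<^sub>0 int) set \<Rightarrow> ('a list \<Rightarrow> 'g::ab_group_add) set"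
  where "annihilator n N = {f \<in> carrier (cochain_group n). \<forall>c\<in>N. linearize f c = 0}"

lemma subgroup_annihilator:
  assumes "N \<subseteq> carrier (chain_group n)"
  shows "subgroup (annihilator n N :: ('a list \<Rightarrow> 'g::ab_group_add) set) (cochain_group n)"
proof -
  interpret comm_group "cochain_group n :: ('a list \<Rightarrow> 'g) monoid"
    by (rule comm_group_cochain_group)
  show ?thesis
  proof (rule subgroupI)
    show "(annihilator n N :: ('a list \<Rightarrow> 'g) set) \<subseteq> carrier (cochain_group n)" by (auto simp: annihilator_def)
    have "(\<one>\<^bsub>cochain_group n\<^esub> :: 'a list \<Rightarrow> 'g) \<in> annihilator n N"
      using one_closed linearize_one[of _ n] assms unfolding annihilator_def by blast
    then show "(annihilator n N :: ('a list \<Rightarrow> 'g) set) \<noteq> {}" by blast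
  next
    fix f :: "'a list \<Rightarrow> 'g" assume f: "f \<in> annihilator n N"
    then have carrier: "f \<in> carrier (cochain_group n)" by (simp add: annihilator_def)
    have "linearize (inv\<^bsub>cochain_group n\<^esub> f) c = 0" if "c \<in> N" for c
    proof -
      have c: "c \<in> carrier (chain_group n)" using that assms by blast
      have "linearize f c = 0" using f that by (simp add: annihilator_def)
      \<comment> \<open>No formula for the inverse is required: the values of \<open>f\<close> and
        its inverse on \<open>c\<close> add up to 0.\<close>
      with linearize_mult[OF c, of "inv\<^bsub>cochain_group n\<^esub> f" f] show ?thesis
        unfolding l_inv[OF carrier] linearize_one[OF c] by simp
    qed
    then show "inv\<^bsub>cochain_group n\<^esub> f \<in> annihilator n N"
      using inv_closed[OF carrier] by (simp add: annihilator_def)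
  next
    fix f g :: "'a list \<Rightarrow> 'g" assume fg: "f \<in> annihilator n N" "g \<in> annihilator n N"
    have "linearize (f \<otimes>\<^bsub>cochain_group n\<^esub> g) c = 0" if "c \<in> N" for c
    proof -
      have "c \<in> carrier (chain_group n)" using that assms by blast
      from linearize_mult[OF this, of f g] show ?thesis
        using fg that by (simp add: annihilator_def)
    qed
    then show "f \<otimes>\<^bsub>cochain_group n\<^esub> g \<in> annihilator n N"
      using m_closed[of f g] fg unfolding annihilator_def by blast
  qed
qed

lemma annihilator_generate:
  assumes "S \<subseteq> carrier (chain_group n)" "\<And>c. c \<in> S \<Longrightarrow> linearize f c = 0"
    and "c \<in> generate (chain_group n) S"
  shows "linearize f c = 0"
proof -
  have "linearize f c \<in> {0}"
    by (rule additive_image_generate[OF additive_linearize assms(1) _ _ assms(3)])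
      (simp_all add: additive_closed_def assms(2))
  then show ?thesis by simp
qed

text \<open>Shuffle cochains are tested on partial shuffles with coefficient 1, whereas integral
  \<open>ShC\<close> is generated by those with any integer coefficient.\<close>

lemma partial_shuffle_int:
  "partial_shuffle i j r as (n :: int) = int_smult n (partial_shuffle i j r as 1)"
proof -
  have "additive (partial_shuffle i j r as :: int \<Rightarrow> _)"
    unfolding partial_shuffle_def
    by (intro additive_sum additive_compose[OF additive_int_smult])
      (simp add: additive_def single_add)
  from additive.commute_int_smult[OF this, of n 1] show ?thesis by (simp add: int_smult_int_1)
qed

lemma shuffle_cochains_eq_annihilator: "shuffle_cochains i j = annihilator (i + j) (ShC i j)"
proof (intro equalityI subsetI)
  fix f :: "'a list \<Rightarrow> 'b"
  assume f: "f \<in> shuffle_cochains i j"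
  have *: "linearize f (partial_shuffle i j r as n) = 0"
    if "1 \<le> r" "r \<le> j - 1" "as \<in> tuples (i + j)" for r as n
    using f that unfolding partial_shuffle_int[of i j r as n]
    by (simp add: shuffle_cochains_def additive.commute_int_smult[OF additive_linearize])
  have "linearize f c = 0" if "c \<in> ShC i j" for c
    by (rule annihilator_generate[OF ShC_generators_closed _ that[unfolded ShC_def]]) (use * in blast)
  with f show "f \<in> annihilator (i + j) (ShC i j)"
    unfolding annihilator_def shuffle_cochains_def by blast
next
  fix f :: "'a list \<Rightarrow> 'b"
  assume f: "f \<in> annihilator (i + j) (ShC i j)"
  have "partial_shuffle i j r as (1 :: int) \<in> ShC i j"
    if "1 \<le> r" "r \<le> j - 1" "as \<in> tuples (i + j)" for r and as :: "'a list"
    unfolding ShC_def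
    by (rule generate.incl, rule CollectI, rule exI[of _ r], rule exI[of _ as], rule exI[of _ 1])
      (use that in simp)
  with f show "f \<in> shuffle_cochains i j"
    unfolding annihilator_def shuffle_cochains_def by blast
qed

text \<open>Vanishing on a sum of subgroups amounts to vanishing on their union, so the union stands
  in for the sum that defines the normalized chains.\<close>

lemma normalized_cochains_eq_annihilator:
  "normalized_cochains i j = annihilator (i + j) (ShC i j \<union> CD i j)"
proof (intro equalityI subsetI)
  fix f :: "'a list \<Rightarrow> 'b"
  assume f: "f \<in> normalized_cochains i j"
  have "linearize f c = 0" if "c \<in> CD i j" for c
    using that unfolding CD_def
    by (rule annihilator_generate[OF CD_generators_closed, rotated])
      (use f in \<open>auto simp: normalized_cochains_def\<close>)
  with f show "f \<in> annihilator (i + j) (ShC i j \<union> CD i j)"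
    by (auto simp: annihilator_def normalized_cochains_def shuffle_cochains_eq_annihilator)
next
  fix f :: "'a list \<Rightarrow> 'b"
  assume f: "f \<in> annihilator (i + j) (ShC i j \<union> CD i j)"
  have "f as = 0" if "as \<in> tuples (i + j)" "0 \<in> set as" for as
    using f CD_generators[OF that, of "1 :: int"] by (force simp: annihilator_def)
  with f show "f \<in> normalized_cochains i j"
    by (simp add: annihilator_def normalized_cochains_def shuffle_cochains_eq_annihilator)
qed

lemma codh_annihilator:
  assumes "N \<subseteq> carrier (chain_group (i + 1 + j))" "\<And>c. c \<in> N \<Longrightarrow> dh dot (i + 1) j c \<in> M"
    and "f \<in> annihilator n M"
  shows "codh dot i j f \<in> annihilator (i + 1 + j) N"
proof -
  have "linearize (codh dot i j f) c = 0" if "c \<in> N" for c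
  proof -
    have "c \<in> carrier (chain_group (i + 1 + j))" using that assms(1) by blast
    then show ?thesis
      using assms(2)[OF that] assms(3) by (simp only: linearize_codh) (simp add: annihilator_def)
  qed
  moreover have "codh dot i j f \<in> carrier (cochain_group (i + 1 + j))" by (simp add: codh_def)
  ultimately show ?thesis unfolding annihilator_def by blast
qed

lemma codv_annihilator:
  assumes "N \<subseteq> carrier (chain_group (i + (j + 1)))" "\<And>c. c \<in> N \<Longrightarrow> dv i (j + 1) c \<in> M"
    and "f \<in> annihilator n M"
  shows "codv i j f \<in> annihilator (i + (j + 1)) N"
proof -
  have "linearize (codv i j f) c = 0" if "c \<in> N" for c
  proof -
    have "c \<in> carrier (chain_group (i + (j + 1)))" using that assms(1) by blast
    then show ?thesis
      using assms(2)[OF that] assms(3) by (simp only: linearize_codv) (simp add: annihilator_def)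
  qed
  moreover have "codv i j f \<in> carrier (cochain_group (i + (j + 1)))" by (simp add: codv_def)
  ultimately show ?thesis unfolding annihilator_def by blast
qed

theorem theorem4p1:
  fixes dot :: "'a::ab_group_add \<Rightarrow> 'a \<Rightarrow> 'a"
  assumes "linear_cycle_set dot"
  shows
    "(let C = (\<lambda>i j. chain_group (i + j)) :: nat \<Rightarrow> nat \<Rightarrow> ('a list \<Rightarrow>\<^sub>0 'g::ab_group_add) monoid
      in chain_bicomplex C (dh dot) dv
         \<and> chain_restricts_to C (dh dot) dv ShC
         \<and> chain_restricts_to C (dh dot) dv CD
         \<and> induces_quotient_chain_bicomplex C (dh dot) dv ShC
         \<and> induces_quotient_chain_bicomplex C (dh dot) dv (\<lambda>i j. CD i j <#>\<^bsub>C i j\<^esub> ShC i j))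
     \<and>
     (let F = (\<lambda>i j. cochain_group (i + j)) :: nat \<Rightarrow> nat \<Rightarrow> ('a list \<Rightarrow> 'g) monoid
      in cochain_bicomplex F (codh dot) codv
         \<and> cochain_restricts_to F (codh dot) codv shuffle_cochains
         \<and> cochain_restricts_to F (codh dot) codv normalized_cochains)"
proof -
  let ?C = "(\<lambda>i j. chain_group (i + j)) :: nat \<Rightarrow> nat \<Rightarrow> ('a list \<Rightarrow>\<^sub>0 'g) monoid"
  let ?F = "(\<lambda>i j. cochain_group (i + j)) :: nat \<Rightarrow> nat \<Rightarrow> ('a list \<Rightarrow> 'g) monoid"
  interpret C: chain_bicomplex ?C "dh dot" dv
    by (rule chain_bicomplex_chain_group[OF assms])
  interpret F: cochain_bicomplex ?F "codh dot" codv
    by (rule cochain_bicomplex_cochain_group[OF assms])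
  have "chain_restricts_to ?C (dh dot) dv ShC"
    by (rule C.restricts_to[OF subgroup_ShC dh_ShC dv_ShC])
  moreover have "chain_restricts_to ?C (dh dot) dv CD"
    by (rule C.restricts_to[OF subgroup_CD dh_CD[OF assms] dv_CD])
  moreover have "induces_quotient_chain_bicomplex ?C (dh dot) dv ShC"
    by (rule C.induces_quotient[OF subgroup_ShC dh_ShC dv_ShC])
  moreover have "induces_quotient_chain_bicomplex ?C (dh dot) dv (\<lambda>i j. CD i j <#>\<^bsub>?C i j\<^esub> ShC i j)"
  proof (rule C.induces_quotient)
    fix i j :: nat and x
    show "subgroup (CD i j <#>\<^bsub>?C i j\<^esub> ShC i j) (?C i j)"
      by (rule comm_group.mult_subgroups[OF comm_group_chain_group subgroup_CD subgroup_ShC])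
    show "dh dot i j x \<in> CD (i - 1) j <#>\<^bsub>?C (i - 1) j\<^esub> ShC (i - 1) j"
      if "1 \<le> i" "1 \<le> j" "x \<in> CD i j <#>\<^bsub>?C i j\<^esub> ShC i j"
      \<comment> \<open>Each summand is preserved separately, and additivity of the differential
        puts the images back into the sum.\<close>
      using that(3) dh_CD[OF assms that(1,2)] dh_ShC[OF that(1,2)]
      by (fastforce simp: set_mult_def additive.add[OF additive_dh])
    show "dv i j x \<in> CD i (j - 1) <#>\<^bsub>?C i (j - 1)\<^esub> ShC i (j - 1)"
      if "2 \<le> j" "x \<in> CD i j <#>\<^bsub>?C i j\<^esub> ShC i j"
      using that(2) dv_CD[OF that(1)] dv_ShC[OF that(1)]
      by (fastforce simp: set_mult_def additive.add[OF additive_dv])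
  qed
  moreover have "cochain_restricts_to ?F (codh dot) codv shuffle_cochains"
  proof (rule F.restricts_to; unfold shuffle_cochains_eq_annihilator)
    fix i j :: nat and f :: "'a list \<Rightarrow> 'g"
    assume j: "1 \<le> j"
    show "subgroup (annihilator (i + j) (ShC i j)) (cochain_group (i + j) :: ('a list \<Rightarrow> 'g) monoid)"
      by (rule subgroup_annihilator[OF subgroup.subset[OF subgroup_ShC]])
    assume f: "f \<in> annihilator (i + j) (ShC i j)"
    show "codh dot i j f \<in> annihilator (i + 1 + j) (ShC (i + 1) j)"
      by (rule codh_annihilator[OF subgroup.subset[OF subgroup_ShC] _ f])
        (use j dh_ShC[of "i + 1" j] in simp)
    show "codv i j f \<in> annihilator (i + (j + 1)) (ShC i (j + 1))"
      by (rule codv_annihilator[OF subgroup.subset[OF subgroup_ShC] _ f])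
        (use j dv_ShC[of "j + 1"] in simp)
  qed
  moreover have "cochain_restricts_to ?F (codh dot) codv normalized_cochains"
  proof (rule F.restricts_to; unfold normalized_cochains_eq_annihilator)
    fix i j :: nat and f :: "'a list \<Rightarrow> 'g"
    assume j: "1 \<le> j"
    have sub: "ShC i j \<union> CD i j \<subseteq> carrier (chain_group (i + j) :: ('a list \<Rightarrow>\<^sub>0 int) monoid)" for i j
      using subgroup.subset[OF subgroup_ShC] subgroup.subset[OF subgroup_CD] by blast
    show "subgroup (annihilator (i + j) (ShC i j \<union> CD i j))
        (cochain_group (i + j) :: ('a list \<Rightarrow> 'g) monoid)"
      by (rule subgroup_annihilator[OF sub])
    assume f: "f \<in> annihilator (i + j) (ShC i j \<union> CD i j)"
    show "codh dot i j f \<in> annihilator (i + 1 + j) (ShC (i + 1) j \<union> CD (i + 1) j)"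
      by (rule codh_annihilator[OF sub _ f])
        (use j dh_ShC[of "i + 1" j] dh_CD[OF assms, of "i + 1" j] in auto)
    show "codv i j f \<in> annihilator (i + (j + 1)) (ShC i (j + 1) \<union> CD i (j + 1))"
      by (rule codv_annihilator[OF sub _ f])
        (use j dv_ShC[of "j + 1"] dv_CD[of "j + 1"] in auto)
  qed
  ultimately show ?thesis
    unfolding Let_def using C.chain_bicomplex_axioms F.cochain_bicomplex_axioms by blast
qed

end
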